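(* Let $R$ be an almost Dedekind domain and let $\alpha$ be an ordinal. Let $\ell$ be a singular length function on $R$ with ideal colength $\tau$. Then for every ideal $I$ of $R$, \[ \tau(I)=\tau(\mathrm{rad}(I))+(\tau\otimes T_\alpha)(I). \]
   Context: $R$ almost Dedekind: $R_M$ is a DVR for each maximal $M$; $K$ the quotient field. A singular length function on $R$ is a map $\ell$ from $R$-modules to $\{0,\infty\}$ with $\ell(0)=0$, $\ell(M_2)=\ell(M_1)+\ell(M_3)$ for every short exact sequence $0\to M_1\to M_2\to M_3\to0$, and $\ell(M)=\sup\{\ell(N)\mid N\subseteq M$ finitely generated$\}$. Its ideal colength is $\tau(I)=\ell(R/I)$. For a flat overring $T$, $(\tau\otimes T)(I)=\ell(R/I\otimes_R T)=\ell(T/IT)$. A maximal ideal $M$ of an almost Dedekind domain $A$ is critical if every finitely generated ideal contained in $M$ is contained in $N^2$ for some maximal ideal $N$; $\mathrm{Crit}(A)$ is the set of critical maximal ideals. Recursively: $\mathrm{Crit}_0(R)=\mathrm{Max}(R)$, $T_0=R$; $\mathrm{Crit}_{\gamma+1}(R)=\{P\in\mathrm{Max}(R)\mid PT_\gamma\in\mathrm{Crit}(T_\gamma)\}$; $\mathrm{Crit}_\lambda(R)=\bigcap_{\gamma<\lambda}\mathrm{Crit}_\gamma(R)$ for limit $\lambda$; and $T_\alpha=\bigcap\{R_P\mid P\in\mathrm{Crit}_\alpha(R)\}$ (equal to $K$ if the set is empty). *)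

theory Defs
  imports Main "HOL-Library.Extended_Nat"
begin

text \<open>Ambient field 'k plays the role of the quotient field K; rings are subrings of 'k.\<close>

definition subring_of :: "'k::field set \<Rightarrow> bool" where
  "subring_of A \<longleftrightarrow> 0 \<in> A \<and> 1 \<in> A \<and>
     (\<forall>x\<in>A. \<forall>y\<in>A. x + y \<in> A \<and> x - y \<in> A \<and> x * y \<in> A)"

definition ideal_of :: "'k::field set \<Rightarrow> 'k set \<Rightarrow> bool" where
  "ideal_of A I \<longleftrightarrow> I \<subseteq> A \<and> 0 \<in> I \<and> (\<forall>x\<in>I. \<forall>y\<in>I. x + y \<in> I) \<and>
     (\<forall>a\<in>A. \<forall>x\<in>I. a * x \<in> I)"

definition max_ideals :: "'k::field set \<Rightarrow> 'k set set" where
  "max_ideals A = {M. ideal_of A M \<and> M \<noteq> A \<and>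
     (\<forall>J. ideal_of A J \<and> M \<subseteq> J \<longrightarrow> J = M \<or> J = A)}"

definition gen_ideal :: "'k::field set \<Rightarrow> 'k set \<Rightarrow> 'k set" where
  "gen_ideal A X = {(\<Sum>i<n. t i * x i) | (n::nat) t x. \<forall>i<n. t i \<in> A \<and> x i \<in> X}"

definition fg_ideal :: "'k::field set \<Rightarrow> 'k set \<Rightarrow> bool" where
  "fg_ideal A J \<longleftrightarrow> (\<exists>F. finite F \<and> F \<subseteq> A \<and> J = gen_ideal A F)"

definition ideal_square :: "'k::field set \<Rightarrow> 'k set \<Rightarrow> 'k set" where
  "ideal_square A N = gen_ideal A {a * b | a b. a \<in> N \<and> b \<in> N}"

definition rad :: "'k::field set \<Rightarrow> 'k set \<Rightarrow> 'k set" where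
  "rad A I = {x \<in> A. \<exists>n::nat. x ^ n \<in> I}"

definition loc :: "'k::field set \<Rightarrow> 'k set \<Rightarrow> 'k set" where
  "loc A P = {a / s | a s. a \<in> A \<and> s \<in> A \<and> s \<notin> P}"

definition is_DVR :: "'k::field set \<Rightarrow> bool" where
  "is_DVR V \<longleftrightarrow> (\<exists>v :: 'k \<Rightarrow> int.
     (\<forall>x y. x \<noteq> 0 \<longrightarrow> y \<noteq> 0 \<longrightarrow> v (x * y) = v x + v y) \<and>
     (\<forall>x y. x \<noteq> 0 \<longrightarrow> y \<noteq> 0 \<longrightarrow> x + y \<noteq> 0 \<longrightarrow> v (x + y) \<ge> min (v x) (v y)) \<and>
     (\<exists>x. x \<noteq> 0 \<and> v x = 1) \<and>
     V = {x. x = 0 \<or> v x \<ge> 0})"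

definition almost_dedekind :: "'k::field set \<Rightarrow> bool" where
  "almost_dedekind A \<longleftrightarrow> subring_of A \<and> (\<forall>M\<in>max_ideals A. is_DVR (loc A M))"

definition critical :: "'k::field set \<Rightarrow> 'k set \<Rightarrow> bool" where
  "critical A M \<longleftrightarrow> M \<in> max_ideals A \<and>
     (\<forall>J. fg_ideal A J \<and> J \<subseteq> M \<longrightarrow> (\<exists>N\<in>max_ideals A. J \<subseteq> ideal_square A N))"

definition Crit :: "'k::field set \<Rightarrow> 'k set set" where
  "Crit A = {M. critical A M}"

text \<open>T = intersection of the localizations at a set of primes (= K = UNIV when empty).\<close>
definition T_of :: "'k::field set \<Rightarrow> 'k set set \<Rightarrow> 'k set" where
  "T_of R C = \<Inter> (loc R ` C)"

text \<open>Ordinals are represented by elements of a well-ordered type 'o; transfinite recursion.\<close>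
definition crit_rec :: "'k::field set \<Rightarrow> 'o::wellorder \<Rightarrow> 'k set set" where
  "crit_rec R = wfrec {(x, y). x < y} (\<lambda>f \<gamma>.
     if (\<forall>\<beta>. \<not> \<beta> < \<gamma>) then max_ideals R
     else if (\<exists>\<beta>. \<beta> < \<gamma> \<and> (\<forall>\<delta>. \<delta> < \<gamma> \<longrightarrow> \<delta> \<le> \<beta>)) then
       (let \<beta> = (THE \<beta>. \<beta> < \<gamma> \<and> (\<forall>\<delta>. \<delta> < \<gamma> \<longrightarrow> \<delta> \<le> \<beta>)) in
         {P \<in> max_ideals R. gen_ideal (T_of R (f \<beta>)) P \<in> Crit (T_of R (f \<beta>))})
     else \<Inter> (f ` {\<beta>. \<beta> < \<gamma>}))"

definition T_alpha :: "'k::field set \<Rightarrow> 'o::wellorder \<Rightarrow> 'k set" where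
  "T_alpha R \<alpha> = T_of R (crit_rec R \<alpha>)"

record ('r, 'm) rmod =
  mcarrier :: "'m set"
  madd :: "'m \<Rightarrow> 'm \<Rightarrow> 'm"
  mzero :: 'm
  msmult :: "'r \<Rightarrow> 'm \<Rightarrow> 'm"

definition is_module :: "'k::field set \<Rightarrow> ('k, 'm) rmod \<Rightarrow> bool" where
  "is_module R M \<longleftrightarrow> (let C = mcarrier M in
     mzero M \<in> C \<and>
     (\<forall>x\<in>C. \<forall>y\<in>C. madd M x y \<in> C) \<and>
     (\<forall>r\<in>R. \<forall>x\<in>C. msmult M r x \<in> C) \<and>
     (\<forall>x\<in>C. \<forall>y\<in>C. \<forall>z\<in>C. madd M (madd M x y) z = madd M x (madd M y z)) \<and>
     (\<forall>x\<in>C. \<forall>y\<in>C. madd M x y = madd M y x) \<and>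
     (\<forall>x\<in>C. madd M (mzero M) x = x) \<and>
     (\<forall>x\<in>C. \<exists>y\<in>C. madd M x y = mzero M) \<and>
     (\<forall>r\<in>R. \<forall>x\<in>C. \<forall>y\<in>C. msmult M r (madd M x y) = madd M (msmult M r x) (msmult M r y)) \<and>
     (\<forall>r\<in>R. \<forall>s\<in>R. \<forall>x\<in>C. msmult M (r + s) x = madd M (msmult M r x) (msmult M s x)) \<and>
     (\<forall>r\<in>R. \<forall>s\<in>R. \<forall>x\<in>C. msmult M (r * s) x = msmult M r (msmult M s x)) \<and>
     (\<forall>x\<in>C. msmult M 1 x = x))"

definition linear_map :: "'k::field set \<Rightarrow> ('k, 'm) rmod \<Rightarrow> ('k, 'n) rmod \<Rightarrow> ('m \<Rightarrow> 'n) \<Rightarrow> bool" where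
  "linear_map R M N f \<longleftrightarrow>
     (\<forall>x\<in>mcarrier M. f x \<in> mcarrier N) \<and>
     (\<forall>x\<in>mcarrier M. \<forall>y\<in>mcarrier M. f (madd M x y) = madd N (f x) (f y)) \<and>
     (\<forall>r\<in>R. \<forall>x\<in>mcarrier M. f (msmult M r x) = msmult N r (f x))"

definition short_exact :: "'k::field set \<Rightarrow> ('k, 'm) rmod \<Rightarrow> ('k, 'm) rmod \<Rightarrow> ('k, 'm) rmod
    \<Rightarrow> ('m \<Rightarrow> 'm) \<Rightarrow> ('m \<Rightarrow> 'm) \<Rightarrow> bool" where
  "short_exact R M1 M2 M3 f g \<longleftrightarrow>
     is_module R M1 \<and> is_module R M2 \<and> is_module R M3 \<and>
     linear_map R M1 M2 f \<and> linear_map R M2 M3 g \<and>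
     inj_on f (mcarrier M1) \<and> g ` mcarrier M2 = mcarrier M3 \<and>
     f ` mcarrier M1 = {x \<in> mcarrier M2. g x = mzero M3}"

definition lincomb :: "('k, 'm) rmod \<Rightarrow> 'k list \<Rightarrow> 'm list \<Rightarrow> 'm" where
  "lincomb M rs xs = foldr (\<lambda>(r, x) acc. madd M (msmult M r x) acc) (zip rs xs) (mzero M)"

definition span :: "'k::field set \<Rightarrow> ('k, 'm) rmod \<Rightarrow> 'm set \<Rightarrow> 'm set" where
  "span R M F = {lincomb M rs xs | rs xs. length rs = length xs \<and> set rs \<subseteq> R \<and> set xs \<subseteq> F}"

text \<open>Singular length functions, on R-modules whose elements have type 'k set
  (large enough to contain R/I and T/IT, realised as sets of cosets in K).\<close>
definition singular_length_function :: "'k::field set \<Rightarrow> (('k, 'k set) rmod \<Rightarrow> enat) \<Rightarrow> bool" where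
  "singular_length_function R ell \<longleftrightarrow>
     (\<forall>M. is_module R M \<longrightarrow> ell M \<in> {0, \<infinity>}) \<and>
     (\<forall>M. is_module R M \<and> mcarrier M = {mzero M} \<longrightarrow> ell M = 0) \<and>
     (\<forall>M1 M2 M3 f g. short_exact R M1 M2 M3 f g \<longrightarrow> ell M2 = ell M1 + ell M3) \<and>
     (\<forall>M. is_module R M \<longrightarrow>
        ell M = (SUP F \<in> {F. finite F \<and> F \<subseteq> mcarrier M}. ell (M\<lparr>mcarrier := span R M F\<rparr>)))"

text \<open>The R-module T/J (R \<subseteq> T, J an ideal of T), elements are cosets x + J.\<close>
definition quot_mod :: "'k::field set \<Rightarrow> 'k set \<Rightarrow> ('k, 'k set) rmod" where
  "quot_mod T J = \<lparr> mcarrier = {(\<lambda>y. x + y) ` J | x. x \<in> T},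
                    madd = (\<lambda>A B. {a + b | a b. a \<in> A \<and> b \<in> B}),
                    mzero = J,
                    msmult = (\<lambda>r A. {r * a + j | a j. a \<in> A \<and> j \<in> J}) \<rparr>"

definition colength :: "'k::field set \<Rightarrow> (('k, 'k set) rmod \<Rightarrow> enat) \<Rightarrow> 'k set \<Rightarrow> enat" where
  "colength R ell I = ell (quot_mod R I)"

definition tensor_colength :: "'k::field set \<Rightarrow> (('k, 'k set) rmod \<Rightarrow> enat) \<Rightarrow> 'k set \<Rightarrow> 'k set \<Rightarrow> enat" where
  "tensor_colength R ell T I = ell (quot_mod T (gen_ideal T I))"

end

theory Submission
  imports Defs
begin

text \<open>
  Call an ideal \<open>J\<close> null if \<open>\<tau>(J) = 0\<close>. The null ideals form a Gabriel filter, so the saturation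
  \<open>H = {x. (I : x) null}\<close> satisfies: \<open>(H : y)\<close> null implies \<open>y \<in> H\<close>. The heart of the matter is that
  \<open>I\<close> is null as soon as \<open>rad(I)\<close> is null and no prime of \<open>Crit\<^sub>\<alpha>\<close> contains \<open>I\<close>. Otherwise \<open>H\<close> is proper, and
  there is a least index at which some maximal ideal \<open>P \<supseteq> H\<close> leaves the sequence of critical sets; it is
  a successor \<open>\<gamma> + 1\<close>, and all maximal ideals containing \<open>H\<close> lie in \<open>Crit\<^sub>\<gamma>\<close>. Since \<open>P T\<^sub>\<gamma>\<close> is not
  critical, it contains finitely many elements \<open>j\<^sub>1, \<dots>, j\<^sub>n\<close> such that every maximal \<open>N \<supseteq> H\<close> has
  \<open>v\<^sub>N(j\<^sub>i) \<le> 1\<close> for some \<open>i\<close>. Take \<open>0 \<noteq> a \<in> H\<close>, put \<open>k = v\<^sub>P(a)\<close> and choose \<open>y \<notin> P\<close> with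
  \<open>y j\<^sub>i\<^sup>k \<in> aR\<close> for all \<open>i\<close>. Then \<open>v\<^sub>N(y) + k \<ge> v\<^sub>N(a)\<close> for all \<open>N \<supseteq> H\<close>, so
  \<open>y rad(I)\<^sup>k \<subseteq> H\<close>, and saturation gives \<open>y \<in> H \<subseteq> P\<close>, a contradiction. The theorem follows by applying
  this to \<open>(I : x)\<close> for \<open>x \<in> I T\<^sub>\<alpha> \<inter> R\<close>.
\<close>

section \<open>Quotients of submodules of the field\<close>

text \<open>\<open>N\<close> may reach outside \<open>R\<close>: overrings \<open>T\<close> and
  their ideals are handled as \<open>R\<close>-submodules of the field as well.\<close>

definition submod :: "'k::field set \<Rightarrow> 'k set \<Rightarrow> bool" where
  "submod R N \<longleftrightarrow> 0 \<in> N \<and> (\<forall>x\<in>N. \<forall>y\<in>N. x + y \<in> N) \<and> (\<forall>r\<in>R. \<forall>x\<in>N. r * x \<in> N)"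

definition coset :: "'k::field \<Rightarrow> 'k set \<Rightarrow> 'k set" where
  "coset x J = (\<lambda>y. x + y) ` J"

text \<open>The annihilator of the class of \<open>x\<close> modulo \<open>J\<close>;
  \<open>x\<close> may be any element of the field.\<close>

definition colon :: "'k::field set \<Rightarrow> 'k set \<Rightarrow> 'k \<Rightarrow> 'k set" where
  "colon R J x = {r \<in> R. r * x \<in> J}"

lemma subring_ofD:
  assumes "subring_of R"
  shows "0 \<in> R" "1 \<in> R" "\<And>x y. x \<in> R \<Longrightarrow> y \<in> R \<Longrightarrow> x + y \<in> R"
    "\<And>x y. x \<in> R \<Longrightarrow> y \<in> R \<Longrightarrow> x - y \<in> R" "\<And>x y. x \<in> R \<Longrightarrow> y \<in> R \<Longrightarrow> x * y \<in> R"
    "\<And>x. x \<in> R \<Longrightarrow> - x \<in> R" "\<And>x n. x \<in> R \<Longrightarrow> x ^ n \<in> R"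
proof -
  show A: "0 \<in> R" "1 \<in> R" "\<And>x y. x \<in> R \<Longrightarrow> y \<in> R \<Longrightarrow> x + y \<in> R"
    "\<And>x y. x \<in> R \<Longrightarrow> y \<in> R \<Longrightarrow> x - y \<in> R" "\<And>x y. x \<in> R \<Longrightarrow> y \<in> R \<Longrightarrow> x * y \<in> R"
    using assms by (auto simp: subring_of_def)
  show "- x \<in> R" if "x \<in> R" for x
    using A(4)[OF A(1) that] by simp
  show "x ^ n \<in> R" if "x \<in> R" for x n
    using that A by (induction n) auto
qed

lemma submodD:
  assumes "submod R N"
  shows "0 \<in> N" "\<And>x y. x \<in> N \<Longrightarrow> y \<in> N \<Longrightarrow> x + y \<in> N" "\<And>r x. r \<in> R \<Longrightarrow> x \<in> N \<Longrightarrow> r * x \<in> N"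
  using assms by (auto simp: submod_def)

lemma submod_minus:
  assumes "subring_of R" "submod R N"
  shows "x \<in> N \<Longrightarrow> - x \<in> N" "x \<in> N \<Longrightarrow> y \<in> N \<Longrightarrow> x - y \<in> N"
proof -
  have 1: "- x \<in> N" if "x \<in> N" for x
    using submodD(3)[OF assms(2), of "- 1" x] subring_ofD(2,6)[OF assms(1)] that by simp
  then show "x \<in> N \<Longrightarrow> - x \<in> N" .
  show "x \<in> N \<Longrightarrow> y \<in> N \<Longrightarrow> x - y \<in> N"
    using submodD(2)[OF assms(2), of x "- y"] 1 by simp
qed

lemma ideal_of_iff_submod: "ideal_of R I \<longleftrightarrow> I \<subseteq> R \<and> submod R I"
  by (auto simp: ideal_of_def submod_def)

lemma submod_self: "subring_of R \<Longrightarrow> submod R R"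
  by (auto simp: subring_of_def submod_def)

lemma submod_subring: "submod T N \<Longrightarrow> R \<subseteq> T \<Longrightarrow> submod R N"
  by (auto simp: submod_def)

lemma ideal_of_eq_self:
  assumes "ideal_of R I" "1 \<in> I"
  shows "I = R"
proof -
  have "r * 1 \<in> I" if "r \<in> R" for r
    using assms that unfolding ideal_of_def by blast
  then show ?thesis using assms by (auto simp: ideal_of_def)
qed

lemma colon_ideal:
  assumes "subring_of R" "submod R J"
  shows "ideal_of R (colon R J x)"
  using submodD[OF assms(2)] subring_ofD[OF assms(1)]
  by (auto simp: ideal_of_def colon_def distrib_right mult.assoc)

lemma submod_insert:
  assumes "subring_of R" "submod R N"
  shows "submod R {r * x + n | r n. r \<in> R \<and> n \<in> N}"
  unfolding submod_def
proof (intro conjI ballI)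
  note R = subring_ofD[OF assms(1)] and N = submodD[OF assms(2)]
  show "0 \<in> {r * x + n | r n. r \<in> R \<and> n \<in> N}"
    using R(1) N(1) by force
  fix a assume "a \<in> {r * x + n | r n. r \<in> R \<and> n \<in> N}"
  then obtain r n where a: "a = r * x + n" "r \<in> R" "n \<in> N" by blast
  {
    fix b assume "b \<in> {r * x + n | r n. r \<in> R \<and> n \<in> N}"
    then obtain r' n' where b: "b = r' * x + n'" "r' \<in> R" "n' \<in> N" by blast
    have "a + b = (r + r') * x + (n + n')"
      unfolding a(1) b(1) by (simp add: algebra_simps)
    then show "a + b \<in> {r * x + n | r n. r \<in> R \<and> n \<in> N}"
      using R(3) N(2) a b by blast
  }
  fix s assume s: "s \<in> R"
  have "s * a = (s * r) * x + s * n"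
    unfolding a(1) by (simp add: algebra_simps)
  then show "s * a \<in> {r * x + n | r n. r \<in> R \<and> n \<in> N}"
    using R(5) N(3) a s by blast
qed

lemma submod_insert_supset:
  assumes "subring_of R" "submod R N"
  shows "N \<subseteq> {r * x + n | r n. r \<in> R \<and> n \<in> N}" "x \<in> {r * x + n | r n. r \<in> R \<and> n \<in> N}"
proof -
  have "n = 0 * x + n" for n by simp
  then show "N \<subseteq> {r * x + n | r n. r \<in> R \<and> n \<in> N}"
    using subring_ofD(1)[OF assms(1)] by blast
  have "x = 1 * x + 0" by simp
  then show "x \<in> {r * x + n | r n. r \<in> R \<and> n \<in> N}"
    using subring_ofD(2)[OF assms(1)] submodD(1)[OF assms(2)] by blast
qed

section \<open>Arithmetic of cosets\<close>

lemma mem_coset_iff: "z \<in> coset x J \<longleftrightarrow> z - x \<in> J"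
  by (auto simp: coset_def image_iff intro!: bexI[of _ "z - x"])

lemma coset_eq_iff:
  assumes "subring_of R" "submod R J"
  shows "coset x J = coset y J \<longleftrightarrow> x - y \<in> J"
proof
  assume "coset x J = coset y J"
  moreover have "x \<in> coset x J" using submodD(1)[OF assms(2)] by (simp add: mem_coset_iff)
  ultimately show "x - y \<in> J" by (simp add: mem_coset_iff)
next
  assume *: "x - y \<in> J"
  show "coset x J = coset y J"
  proof (intro set_eqI)
    fix z
    have "z - x \<in> J \<longleftrightarrow> z - y \<in> J"
      using submodD(2)[OF assms(2), of "z - x" "x - y"] submod_minus(2)[OF assms, of "z - y" "x - y"] *
      by auto
    then show "z \<in> coset x J \<longleftrightarrow> z \<in> coset y J" by (simp add: mem_coset_iff)
  qed
qed

lemma coset_zero: "coset 0 J = J"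
  by (simp add: coset_def)

text \<open>One computation for three uses: scalar multiplication on a quotient
  (\<open>J' = J\<close>), the projection onto a smaller quotient (\<open>r = 1\<close>), and
  multiplication by \<open>x\<close> from \<open>R/(J : x)\<close>. Adding \<open>J\<close> fills up
  the coset, of which the scaled set is only a part.\<close>

lemma coset_scale:
  assumes "subring_of R" "submod R J" and sub: "\<And>z. z \<in> J' \<Longrightarrow> r * z \<in> J" and "0 \<in> J'"
  shows "{r * a + j | a j. a \<in> coset x J' \<and> j \<in> J} = coset (r * x) J"
proof (intro equalityI subsetI)
  fix z assume "z \<in> {r * a + j | a j. a \<in> coset x J' \<and> j \<in> J}"
  then obtain a j where z: "z = r * a + j" "a - x \<in> J'" "j \<in> J" by (auto simp: mem_coset_iff)
  have "z - r * x = r * (a - x) + j" using z by (simp add: algebra_simps)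
  then show "z \<in> coset (r * x) J"
    using sub[OF z(2)] z(3) submodD(2)[OF assms(2)] by (simp add: mem_coset_iff)
next
  fix z assume "z \<in> coset (r * x) J"
  then have "z - r * x \<in> J" by (simp add: mem_coset_iff)
  moreover have "x \<in> coset x J'" using \<open>0 \<in> J'\<close> by (simp add: mem_coset_iff)
  moreover have "z = r * x + (z - r * x)" by simp
  ultimately show "z \<in> {r * a + j | a j. a \<in> coset x J' \<and> j \<in> J}" by blast
qed

lemma coset_add:
  assumes "subring_of R" "submod R J"
  shows "{a + b | a b. a \<in> coset x J \<and> b \<in> coset y J} = coset (x + y) J"
proof (intro equalityI subsetI)
  fix z assume "z \<in> {a + b | a b. a \<in> coset x J \<and> b \<in> coset y J}"
  then obtain a b where z: "z = a + b" "a - x \<in> J" "b - y \<in> J" by (auto simp: mem_coset_iff)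
  have "z - (x + y) = (a - x) + (b - y)" using z by simp
  then show "z \<in> coset (x + y) J"
    using submodD(2)[OF assms(2) z(2,3)] unfolding mem_coset_iff by metis
next
  fix z assume "z \<in> coset (x + y) J"
  then have "z - x \<in> coset y J" by (simp add: mem_coset_iff algebra_simps)
  moreover have "x \<in> coset x J" using submodD(1)[OF assms(2)] by (simp add: mem_coset_iff)
  moreover have "z = x + (z - x)" by simp
  ultimately show "z \<in> {a + b | a b. a \<in> coset x J \<and> b \<in> coset y J}" by blast
qed

section \<open>Quotient modules and their exact sequences\<close>

lemma quot_mod_carrier: "mcarrier (quot_mod N J) = {coset x J | x. x \<in> N}"
  by (simp add: quot_mod_def coset_def)

lemma quot_mod_ops:
  assumes "subring_of R" "submod R J"
  shows "madd (quot_mod N J) (coset x J) (coset y J) = coset (x + y) J"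
    "mzero (quot_mod N J) = coset 0 J"
    "r \<in> R \<Longrightarrow> msmult (quot_mod N J) r (coset x J) = coset (r * x) J"
proof -
  show "madd (quot_mod N J) (coset x J) (coset y J) = coset (x + y) J"
    using coset_add[OF assms] by (simp add: quot_mod_def)
  show "mzero (quot_mod N J) = coset 0 J" by (simp add: quot_mod_def coset_zero)
  assume r: "r \<in> R"
  show "msmult (quot_mod N J) r (coset x J) = coset (r * x) J"
    using coset_scale[OF assms, of J r x] submodD[OF assms(2)] r by (simp add: quot_mod_def)
qed

lemma quot_mod_is_module:
  assumes "subring_of R" "submod R J" "submod R N"
  shows "is_module R (quot_mod N J)"
proof -
  note ops = quot_mod_ops[OF assms(1,2), where N = N]
  note N = submodD[OF assms(3)] submod_minus[OF assms(1,3)]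
  note R = subring_ofD[OF assms(1)]
  have inv: "\<exists>y\<in>mcarrier (quot_mod N J). madd (quot_mod N J) (coset x J) y = coset 0 J" if "x \<in> N" for x
    using that N(4) ops(1)[where x = x and y = "- x"] by (intro bexI[of _ "coset (- x) J"]) (auto simp: quot_mod_carrier)
  have A: "(\<forall>c\<in>mcarrier (quot_mod N J). Q c) \<longleftrightarrow> (\<forall>x\<in>N. Q (coset x J))" for Q
    by (auto simp: quot_mod_carrier)
  have mem: "x \<in> N \<Longrightarrow> coset x J \<in> mcarrier (quot_mod N J)" for x
    by (auto simp: quot_mod_carrier)
  show ?thesis
    unfolding is_module_def Let_def A
    using R by (auto simp: ops mem N inv algebra_simps)
qed

lemma linear_map_scale_cosets:
  assumes R: "subring_of R" and J: "submod R J" and C: "submod R C"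
    and f: "\<And>y. f (coset y C) = coset (x * y) J" and sub: "\<And>y. y \<in> L \<Longrightarrow> x * y \<in> N"
  shows "linear_map R (quot_mod L C) (quot_mod N J) f"
proof -
  note oC = quot_mod_ops[OF R C] and oJ = quot_mod_ops[OF R J]
  have A: "(\<forall>c\<in>mcarrier (quot_mod L C). Q c) \<longleftrightarrow> (\<forall>y\<in>L. Q (coset y C))" for Q
    by (auto simp: quot_mod_carrier)
  show ?thesis
    unfolding linear_map_def A using sub by (auto simp: f oC oJ algebra_simps quot_mod_carrier)
qed

text \<open>The sequence \<open>0 -> N/J -> L/J -> L/N -> 0\<close>. The elements of
  \<open>N/J\<close> already are cosets of \<open>J\<close>, so the first map is the identity; the
  factor \<open>1\<close> gives the projection the shape of \<open>coset_scale\<close>.\<close>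

lemma quot_mod_short_exact:
  assumes R: "subring_of R" and J: "submod R J" and N: "submod R N" and L: "submod R L"
    and "J \<subseteq> N" "N \<subseteq> L"
  shows "short_exact R (quot_mod N J) (quot_mod L J) (quot_mod L N)
           (\<lambda>A. A) (\<lambda>A. {1 * a + n | a n. a \<in> A \<and> n \<in> N})"
proof -
  let ?g = "\<lambda>A. {1 * a + n | a n. a \<in> A \<and> n \<in> N}"
  have g: "?g (coset x J) = coset x N" for x
    using coset_scale[OF R N, of J 1 x] \<open>J \<subseteq> N\<close> submodD(1)[OF J] by auto
  note oJ = quot_mod_ops[OF R J] and oN = quot_mod_ops[OF R N]
  have 1: "linear_map R (quot_mod N J) (quot_mod L J) (\<lambda>A. A)"
    unfolding linear_map_def using \<open>N \<subseteq> L\<close> by (auto simp: quot_mod_carrier oJ)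
  have 2: "linear_map R (quot_mod L J) (quot_mod L N) ?g"
    using g by (intro linear_map_scale_cosets[OF R N J, of _ 1]) auto
  have 3: "?g ` mcarrier (quot_mod L J) = mcarrier (quot_mod L N)"
  proof -
    have "?g ` mcarrier (quot_mod L J) = (\<lambda>x. ?g (coset x J)) ` L"
      unfolding quot_mod_carrier by blast
    also have "\<dots> = mcarrier (quot_mod L N)"
      unfolding g by (auto simp: quot_mod_carrier)
    finally show ?thesis .
  qed
  have gz: "?g (coset x J) = mzero (quot_mod L N) \<longleftrightarrow> x \<in> N" for x
    unfolding g oN(2) using coset_eq_iff[OF R N, of x 0] by simp
  have 4: "(\<lambda>A. A) ` mcarrier (quot_mod N J) =
      {x \<in> mcarrier (quot_mod L J). ?g x = mzero (quot_mod L N)}" (is "?l = ?r")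
  proof -
    have "?r = {coset x J | x. x \<in> L \<and> ?g (coset x J) = mzero (quot_mod L N)}"
      unfolding quot_mod_carrier by blast
    then show ?thesis unfolding gz using \<open>N \<subseteq> L\<close> by (auto simp: quot_mod_carrier)
  qed
  show ?thesis
    unfolding short_exact_def
    using 1 2 3 4 quot_mod_is_module[OF R] J N L by auto
qed

text \<open>The isomorphism of \<open>R/(J : x)\<close> with \<open>(Rx + J)/J\<close>, stated as a
  short exact sequence ending in the zero module \<open>J/J\<close>, because additivity is the axiom
  through which a length function sees isomorphisms.\<close>

lemma quot_mod_cyclic_short_exact:
  assumes R: "subring_of R" and J: "submod R J"
  shows "short_exact R (quot_mod R (colon R J x)) (quot_mod {r * x + n | r n. r \<in> R \<and> n \<in> J} J)
           (quot_mod J J) (\<lambda>A. {x * a + n | a n. a \<in> A \<and> n \<in> J}) (\<lambda>_. coset 0 J)"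
proof -
  let ?C = "colon R J x" and ?N = "{r * x + n | r n. r \<in> R \<and> n \<in> J}"
  let ?f = "\<lambda>A. {x * a + n | a n. a \<in> A \<and> n \<in> J}"
  have C: "submod R ?C" using colon_ideal[OF R J] by (simp add: ideal_of_iff_submod)
  have f: "?f (coset y ?C) = coset (x * y) J" for y
    using coset_scale[OF R J, of ?C x y] submodD(1)[OF C] by (auto simp: colon_def mult.commute)
  note oC = quot_mod_ops[OF R C] and oJ = quot_mod_ops[OF R J]
  have JJ: "mcarrier (quot_mod J J) = {coset 0 J}"
    using submodD(1)[OF J] coset_eq_iff[OF R J, of _ 0] by (auto simp: quot_mod_carrier)
  have xR: "x * r \<in> ?N" if "r \<in> R" for r
    using that submodD(1)[OF J] by (force simp: mult.commute)
  have 1: "linear_map R (quot_mod R ?C) (quot_mod ?N J) ?f"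
    by (intro linear_map_scale_cosets[OF R J C, of _ x] f xR)
  have 2: "linear_map R (quot_mod ?N J) (quot_mod J J) (\<lambda>_. coset 0 J)"
    unfolding linear_map_def by (auto simp: JJ oJ)
  have 3: "inj_on ?f (mcarrier (quot_mod R ?C))"
  proof (rule inj_onI)
    fix A B assume AB: "A \<in> mcarrier (quot_mod R ?C)" "B \<in> mcarrier (quot_mod R ?C)" and eq: "?f A = ?f B"
    from AB obtain a b where ab: "A = coset a ?C" "B = coset b ?C" "a \<in> R" "b \<in> R"
      by (auto simp: quot_mod_carrier)
    from eq have "coset (x * a) J = coset (x * b) J" unfolding ab f .
    then have "x * a - x * b \<in> J" using coset_eq_iff[OF R J] by blast
    then have "a - b \<in> ?C" using ab(3,4) subring_ofD(4)[OF R] by (simp add: colon_def algebra_simps)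
    then show "A = B" unfolding ab using coset_eq_iff[OF R C] by blast
  qed
  have 4: "?f ` mcarrier (quot_mod R ?C) = mcarrier (quot_mod ?N J)"
  proof -
    have eq: "coset (r * x + n) J = coset (x * r) J" if "n \<in> J" for r n
      using that coset_eq_iff[OF R J] by (simp add: algebra_simps)
    have "?f ` mcarrier (quot_mod R ?C) = (\<lambda>y. ?f (coset y ?C)) ` R"
      unfolding quot_mod_carrier by blast
    also have "\<dots> = {coset (r * x + n) J | r n. r \<in> R \<and> n \<in> J}"
      unfolding f using eq submodD(1)[OF J] by (auto simp: image_iff) metis
    also have "\<dots> = mcarrier (quot_mod ?N J)" by (auto simp: quot_mod_carrier)
    finally show ?thesis .
  qed
  have ne: "mcarrier (quot_mod ?N J) \<noteq> {}"
    using submodD(1)[OF submod_insert[OF R J, of x]] unfolding quot_mod_carrier by blast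
  have 5: "(\<lambda>_. coset 0 J) ` mcarrier (quot_mod ?N J) = mcarrier (quot_mod J J)"
    unfolding JJ using ne by auto
  have 6: "?f ` mcarrier (quot_mod R ?C) = {y \<in> mcarrier (quot_mod ?N J). coset 0 J = mzero (quot_mod J J)}"
    unfolding 4 oJ(2) by simp
  show ?thesis
    unfolding short_exact_def
    by (intro conjI 1 2 3 5 6 quot_mod_is_module[OF R] J C submod_self[OF R] submod_insert[OF R J])
qed

section \<open>Sums, linear spans and finitely generated submodules of a quotient\<close>

lemma submod_sum:
  assumes "submod R S" "submod R J"
  shows "submod R {s + j | s j. s \<in> S \<and> j \<in> J}"
  unfolding submod_def
proof (intro conjI ballI)
  note S = submodD[OF assms(1)] and J = submodD[OF assms(2)]
  show "0 \<in> {s + j | s j. s \<in> S \<and> j \<in> J}" using S(1) J(1) by force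
  fix a assume "a \<in> {s + j | s j. s \<in> S \<and> j \<in> J}"
  then obtain s j where a: "a = s + j" "s \<in> S" "j \<in> J" by blast
  {
    fix b assume "b \<in> {s + j | s j. s \<in> S \<and> j \<in> J}"
    then obtain s' j' where b: "b = s' + j'" "s' \<in> S" "j' \<in> J" by blast
    have "a + b = (s + s') + (j + j')" using a b by (simp add: algebra_simps)
    then show "a + b \<in> {s + j | s j. s \<in> S \<and> j \<in> J}" using S(2) J(2) a b by blast
  }
  fix r assume r: "r \<in> R"
  have "r * a = r * s + r * j" using a by (simp add: algebra_simps)
  then show "r * a \<in> {s + j | s j. s \<in> S \<and> j \<in> J}" using S(3) J(3) a r by blast
qed

text \<open>Lists are used, in contrast to \<open>gen_ideal\<close>, in order to match
  \<open>lincomb\<close>.\<close>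

definition lin_span :: "'k::field set \<Rightarrow> 'k set \<Rightarrow> 'k set" where
  "lin_span R Y = {sum_list (map2 (*) rs ys) | rs ys. length rs = length ys \<and> set rs \<subseteq> R \<and> set ys \<subseteq> Y}"

lemma lin_span_submod:
  assumes "subring_of R"
  shows "submod R (lin_span R Y)"
  unfolding submod_def
proof (intro conjI ballI)
  show "0 \<in> lin_span R Y"
    unfolding lin_span_def by (intro CollectI exI[of _ "[]"]) auto
  fix a assume "a \<in> lin_span R Y"
  then obtain rs ys where a: "a = sum_list (map2 (*) rs ys)" "length rs = length ys" "set rs \<subseteq> R" "set ys \<subseteq> Y"
    by (auto simp: lin_span_def)
  {
    fix b assume "b \<in> lin_span R Y"
    then obtain rs' ys' where b: "b = sum_list (map2 (*) rs' ys')" "length rs' = length ys'" "set rs' \<subseteq> R" "set ys' \<subseteq> Y"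
      by (auto simp: lin_span_def)
    show "a + b \<in> lin_span R Y"
      unfolding lin_span_def using a b
      by (intro CollectI exI[of _ "rs @ rs'"] exI[of _ "ys @ ys'"]) auto
  }
  fix r assume r: "r \<in> R"
  have "r * a = sum_list (map2 (*) (map ((*) r) rs) ys)"
    using a(2) unfolding a(1) by (induction rs ys rule: list_induct2) (auto simp: algebra_simps)
  then show "r * a \<in> lin_span R Y"
    unfolding lin_span_def using a r subring_ofD(5)[OF assms]
    by (intro CollectI exI[of _ "map ((*) r) rs"] exI[of _ ys]) auto
qed

lemma lin_span_minimal:
  assumes "submod R N" "Y \<subseteq> N"
  shows "lin_span R Y \<subseteq> N"
proof
  fix a assume "a \<in> lin_span R Y"
  then obtain rs ys where a: "a = sum_list (map2 (*) rs ys)" "length rs = length ys" "set rs \<subseteq> R" "set ys \<subseteq> Y"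
    by (auto simp: lin_span_def)
  from a(2-4) show "a \<in> N" unfolding a(1)
    by (induction rs ys rule: list_induct2) (use submodD[OF assms(1)] assms(2) in auto)
qed

lemma lincomb_cosets:
  assumes "subring_of R" "submod R J" "length rs = length ys" "set rs \<subseteq> R"
  shows "lincomb (quot_mod L J) rs (map (\<lambda>y. coset y J) ys) = coset (sum_list (map2 (*) rs ys)) J"
  using assms(3,4)
  by (induction rs ys rule: list_induct2)
    (auto simp: lincomb_def quot_mod_ops[OF assms(1,2)])

text \<open>Brings the submodules in the supremum axiom back to the form \<open>quot_mod\<close>.
  \<open>Y\<close> collects all representatives of the cosets in \<open>F\<close>, so it may be
  infinite.\<close>

lemma span_quot_mod:
  assumes R: "subring_of R" and J: "submod R J" and F: "F \<subseteq> mcarrier (quot_mod L J)"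
  defines "Y \<equiv> {y \<in> L. coset y J \<in> F}"
  shows "(quot_mod L J)\<lparr>mcarrier := span R (quot_mod L J) F\<rparr> =
         quot_mod {s + j | s j. s \<in> lin_span R Y \<and> j \<in> J} J"
proof -
  have "span R (quot_mod L J) F = {coset s J | s. s \<in> lin_span R Y}"
  proof (intro equalityI subsetI)
    fix c assume "c \<in> span R (quot_mod L J) F"
    then obtain rs xs where c: "c = lincomb (quot_mod L J) rs xs" "length rs = length xs"
      "set rs \<subseteq> R" "set xs \<subseteq> F" by (auto simp: span_def)
    have "\<forall>x\<in>set xs. \<exists>y. y \<in> L \<and> coset y J = x"
      using c(4) F by (fastforce simp: quot_mod_carrier)
    then obtain p where p: "\<And>x. x \<in> set xs \<Longrightarrow> p x \<in> L \<and> coset (p x) J = x" by metis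
    have xs: "xs = map (\<lambda>y. coset y J) (map p xs)"
      using p by (simp add: map_idI)
    have "c = coset (sum_list (map2 (*) rs (map p xs))) J"
      using lincomb_cosets[OF R J, of rs "map p xs" L] c(1-3) xs by simp
    moreover have "sum_list (map2 (*) rs (map p xs)) \<in> lin_span R Y"
      unfolding lin_span_def using c p
      by (intro CollectI exI[of _ rs] exI[of _ "map p xs"]) (auto simp: Y_def)
    ultimately show "c \<in> {coset s J | s. s \<in> lin_span R Y}" by blast
  next
    fix c assume "c \<in> {coset s J | s. s \<in> lin_span R Y}"
    then obtain rs ys where c: "c = coset (sum_list (map2 (*) rs ys)) J" "length rs = length ys"
      "set rs \<subseteq> R" "set ys \<subseteq> Y" by (auto simp: lin_span_def)
    then have "c = lincomb (quot_mod L J) rs (map (\<lambda>y. coset y J) ys)"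
      using lincomb_cosets[OF R J] by simp
    then show "c \<in> span R (quot_mod L J) F"
      unfolding span_def using c(2-4)
      by (intro CollectI exI[of _ rs] exI[of _ "map (\<lambda>y. coset y J) ys"]) (auto simp: Y_def)
  qed
  also have "\<dots> = mcarrier (quot_mod {s + j | s j. s \<in> lin_span R Y \<and> j \<in> J} J)"
  proof -
    have "coset (s + j) J = coset s J" if "j \<in> J" for s j
      using that coset_eq_iff[OF R J] by simp
    then show ?thesis
      using submodD(1)[OF J] unfolding quot_mod_carrier by (fastforce intro: exI[of _ "_ + 0"])
  qed
  finally show ?thesis by (simp add: quot_mod_def)
qed

section \<open>The filter of null ideals\<close>

locale singular_length =
  fixes R :: "'k::field set" and ell :: "('k, 'k set) rmod \<Rightarrow> enat"
  assumes R: "subring_of R" and ell: "singular_length_function R ell"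
begin

definition null :: "'k set \<Rightarrow> bool" where
  "null I \<longleftrightarrow> ell (quot_mod R I) = 0"

lemma ell_quot_add:
  assumes "submod R J" "submod R N" "submod R L" "J \<subseteq> N" "N \<subseteq> L"
  shows "ell (quot_mod L J) = ell (quot_mod N J) + ell (quot_mod L N)"
  using quot_mod_short_exact[OF R assms] ell unfolding singular_length_function_def by blast

lemma ell_quot_self:
  assumes "submod R J"
  shows "ell (quot_mod J J) = 0"
proof -
  have "mcarrier (quot_mod J J) = {mzero (quot_mod J J)}"
    using submodD(1)[OF assms] coset_eq_iff[OF R assms, of _ 0]
    by (auto simp: quot_mod_carrier quot_mod_ops[OF R assms])
  then show ?thesis
    using ell quot_mod_is_module[OF R assms assms] unfolding singular_length_function_def by blast
qed

lemma ell_cyclic: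
  assumes "submod R J"
  shows "ell (quot_mod {r * x + n | r n. r \<in> R \<and> n \<in> J} J) = ell (quot_mod R (colon R J x))"
proof -
  have "ell (quot_mod {r * x + n | r n. r \<in> R \<and> n \<in> J} J) =
      ell (quot_mod R (colon R J x)) + ell (quot_mod J J)"
    using quot_mod_cyclic_short_exact[OF R assms] ell
    unfolding singular_length_function_def by blast
  then show ?thesis using ell_quot_self[OF assms] by simp
qed

text \<open>\<open>R/J'\<close> is a quotient of \<open>R/J\<close>, and a sum in
  \<open>enat\<close> vanishes only if both summands do.\<close>

lemma null_mono:
  assumes "null J" "ideal_of R J" "ideal_of R J'" "J \<subseteq> J'"
  shows "null J'"
  using ell_quot_add[of J J' R] assms submod_self[OF R] by (simp add: null_def ideal_of_iff_submod)

lemma null_self: "null R"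
  using ell_quot_self[OF submod_self[OF R]] by (simp add: null_def)

text \<open>The elements of \<open>Y\<close> are adjoined one at a time. Adjoining \<open>y\<close>
  to \<open>N\<close> adds the length of \<open>R/(N : y)\<close>, which is zero since
  \<open>(N : y)\<close> contains the null ideal \<open>(J : y)\<close>.\<close>

lemma finite_extension_null:
  assumes "submod R J" "submod R L" "J \<subseteq> L" "\<And>x. x \<in> L \<Longrightarrow> null (colon R J x)"
    and "finite Y" "Y \<subseteq> L"
  shows "\<exists>N. submod R N \<and> J \<subseteq> N \<and> N \<subseteq> L \<and> Y \<subseteq> N \<and> ell (quot_mod N J) = 0"
  using assms(5,6)
proof (induction Y)
  case empty
  show ?case using assms(1,3) ell_quot_self by blast
next
  case (insert y Y)
  then obtain N where N: "submod R N" "J \<subseteq> N" "N \<subseteq> L" "Y \<subseteq> N" "ell (quot_mod N J) = 0" by blast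
  let ?N = "{r * y + n | r n. r \<in> R \<and> n \<in> N}"
  have "null (colon R N y)"
    using insert.prems N(2) assms(4)[of y]
    by (intro null_mono[OF _ colon_ideal[OF R assms(1)] colon_ideal[OF R N(1)]]) (auto simp: colon_def)
  then have "ell (quot_mod ?N N) = 0"
    using ell_cyclic[OF N(1)] by (simp add: null_def)
  moreover have N': "submod R ?N" "N \<subseteq> ?N" "y \<in> ?N"
    using submod_insert[OF R N(1)] submod_insert_supset[OF R N(1)] by blast+
  ultimately have "ell (quot_mod ?N J) = 0"
    using ell_quot_add[OF assms(1) N(1) N'(1) N(2) N'(2)] N(5) by simp
  moreover have "?N \<subseteq> L"
    using submodD[OF assms(2)] insert.prems N(3) by auto
  ultimately show ?case using N N' by (intro exI[of _ ?N]) auto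
qed

text \<open>Vanishing can be tested on annihilators of single elements: \<open>L/J\<close> contains
  the cyclic modules \<open>R/(J : x)\<close>, and conversely every finitely generated submodule
  lies in some \<open>N/J\<close> of length zero. Since \<open>L\<close> may exceed
  \<open>R\<close>, this applies to \<open>T/IT\<close>.\<close>

lemma ell_quot_eq_0_iff:
  assumes J: "submod R J" and L: "submod R L" and "J \<subseteq> L"
  shows "ell (quot_mod L J) = 0 \<longleftrightarrow> (\<forall>x\<in>L. null (colon R J x))"
proof
  assume *: "ell (quot_mod L J) = 0"
  show "\<forall>x\<in>L. null (colon R J x)"
  proof
    fix x assume x: "x \<in> L"
    let ?N = "{r * x + n | r n. r \<in> R \<and> n \<in> J}"
    have "?N \<subseteq> L" using x \<open>J \<subseteq> L\<close> submodD[OF L] by auto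
    then show "null (colon R J x)"
      using ell_quot_add[OF J submod_insert[OF R J, of x] L submod_insert_supset(1)[OF R J]]
        ell_cyclic[OF J, of x] * by (simp add: null_def)
  qed
next
  assume *: "\<forall>x\<in>L. null (colon R J x)"
  have "ell ((quot_mod L J)\<lparr>mcarrier := span R (quot_mod L J) F\<rparr>) = 0"
    if F: "finite F" "F \<subseteq> mcarrier (quot_mod L J)" for F
  proof -
    have "\<forall>c\<in>F. \<exists>y. y \<in> L \<and> coset y J = c"
      using F(2) by (fastforce simp: quot_mod_carrier)
    then obtain p where p: "\<And>c. c \<in> F \<Longrightarrow> p c \<in> L \<and> coset (p c) J = c" by metis
    obtain N where N: "submod R N" "J \<subseteq> N" "N \<subseteq> L" "p ` F \<subseteq> N" "ell (quot_mod N J) = 0"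
      using finite_extension_null[OF J L \<open>J \<subseteq> L\<close>, of "p ` F"] * F(1) p by blast
    let ?Y = "{y \<in> L. coset y J \<in> F}"
    let ?N = "{s + j | s j. s \<in> lin_span R ?Y \<and> j \<in> J}"
    \<comment> \<open>\<open>N\<close> contains only one chosen representative of each coset in
      \<open>F\<close>; the others differ from it by elements of \<open>J\<close>, which lies in
      \<open>N\<close>.\<close>
    have "?Y \<subseteq> N"
    proof
      fix y assume y: "y \<in> ?Y"
      then have "y - p (coset y J) \<in> J" using p coset_eq_iff[OF R J, of y "p (coset y J)"] by auto
      moreover have "p (coset y J) \<in> N" using y N(4) by blast
      ultimately show "y \<in> N"
        using submodD(2)[OF N(1), of "y - p (coset y J)" "p (coset y J)"] N(2) by auto
    qed
    then have "?N \<subseteq> N" using lin_span_minimal[OF N(1)] N(2) submodD(2)[OF N(1)] by blast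
    moreover have "submod R ?N" using submod_sum[OF lin_span_submod[OF R] J] .
    moreover have "J \<subseteq> ?N" using submodD(1)[OF lin_span_submod[OF R]] by force
    ultimately have "ell (quot_mod ?N J) = 0"
      using ell_quot_add[OF J _ N(1), of ?N] N(5) by simp
    then show ?thesis using span_quot_mod[OF R J F(2)] by simp
  qed
  moreover have "ell (quot_mod L J) =
      (SUP F \<in> {F. finite F \<and> F \<subseteq> mcarrier (quot_mod L J)}.
         ell ((quot_mod L J)\<lparr>mcarrier := span R (quot_mod L J) F\<rparr>))"
    using ell quot_mod_is_module[OF R J L] unfolding singular_length_function_def by blast
  moreover have "(SUP F \<in> {F. finite F \<and> F \<subseteq> mcarrier (quot_mod L J)}.
         ell ((quot_mod L J)\<lparr>mcarrier := span R (quot_mod L J) F\<rparr>)) \<le> 0"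
    using calculation(1) by (intro SUP_least) simp
  ultimately show "ell (quot_mod L J) = 0" by simp
qed

text \<open>The transitivity axiom of a Gabriel filter. As \<open>J\<close> need not contain
  \<open>I\<close>, the chain used is \<open>I\<close>, \<open>J + I\<close>, \<open>R\<close>: the
  first factor is killed elementwise by null ideals, the second is a quotient of
  \<open>R/J\<close>.\<close>

lemma null_trans:
  assumes "ideal_of R I" "ideal_of R J" "null J" "\<And>x. x \<in> J \<Longrightarrow> null (colon R I x)"
  shows "null I"
proof -
  let ?S = "{s + j | s j. s \<in> J \<and> j \<in> I}"
  have I: "submod R I" "I \<subseteq> R" and J: "submod R J" "J \<subseteq> R"
    using assms by (auto simp: ideal_of_iff_submod)
  have S: "submod R ?S" using submod_sum[OF J(1) I(1)] .
  have IS: "I \<subseteq> ?S" using submodD(1)[OF J(1)] by force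
  have JS: "J \<subseteq> ?S" using submodD(1)[OF I(1)] by force
  have SR: "?S \<subseteq> R" using I J subring_ofD[OF R] by blast
  have "null (colon R I x)" if x: "x \<in> ?S" for x
  proof -
    from x obtain s j where sj: "x = s + j" "s \<in> J" "j \<in> I" by blast
    have "colon R I s \<subseteq> colon R I x"
      using sj submodD[OF I(1)] by (auto simp: colon_def distrib_left)
    then show ?thesis
      using null_mono[OF assms(4)[OF sj(2)] colon_ideal[OF R I(1)] colon_ideal[OF R I(1)]] by blast
  qed
  then have "ell (quot_mod ?S I) = 0" using ell_quot_eq_0_iff[OF I(1) S IS] by blast
  moreover have "ell (quot_mod R ?S) = 0"
    using null_mono[OF assms(3,2) _ JS] S SR by (simp add: ideal_of_iff_submod null_def)
  ultimately show ?thesis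
    using ell_quot_add[OF I(1) S submod_self[OF R] IS SR] by (simp add: null_def)
qed

text \<open>By transitivity through \<open>A\<close>: for \<open>x\<close> in \<open>A\<close>, the
  product \<open>B x\<close> lies in the intersection.\<close>

lemma null_Int:
  assumes "ideal_of R A" "ideal_of R B" "null A" "null B"
  shows "null (A \<inter> B)"
proof (rule null_trans[OF _ assms(1,3)])
  show AB: "ideal_of R (A \<inter> B)" using assms(1,2) unfolding ideal_of_def by blast
  fix x assume x: "x \<in> A"
  have "B \<subseteq> colon R (A \<inter> B) x"
  proof
    fix b assume b: "b \<in> B"
    have "x \<in> R" "b \<in> R" using x b assms(1,2) by (auto simp: ideal_of_def)
    then have "b * x \<in> A" "x * b \<in> B" using x b assms(1,2) by (auto simp: ideal_of_def)
    then show "b \<in> colon R (A \<inter> B) x" using \<open>b \<in> R\<close> by (simp add: colon_def mult.commute)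
  qed
  then show "null (colon R (A \<inter> B) x)"
    using null_mono[OF assms(4,2) colon_ideal[OF R]] AB by (simp add: ideal_of_iff_submod)
qed

text \<open>The preimage in \<open>R\<close> of the torsion part of \<open>R/I\<close>, that is, of
  the classes generating submodules of length zero.\<close>

definition saturation :: "'k set \<Rightarrow> 'k set" where
  "saturation I = {x \<in> R. null (colon R I x)}"

lemma saturation_ideal:
  assumes "ideal_of R I"
  shows "ideal_of R (saturation I)"
proof -
  have I: "submod R I" using assms by (simp add: ideal_of_iff_submod)
  note colI = colon_ideal[OF R I]
  have "null (colon R I 0)"
  proof -
    have "colon R I 0 = R" using submodD(1)[OF I] by (auto simp: colon_def)
    then show ?thesis using null_self by simp
  qed
  moreover have "null (colon R I (x + y))" if "null (colon R I x)" "null (colon R I y)" for x y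
  proof (rule null_mono[OF null_Int[OF colI colI that] _ colI])
    show "ideal_of R (colon R I x \<inter> colon R I y)"
      using colI[of x] colI[of y] unfolding ideal_of_def by blast
    show "colon R I x \<inter> colon R I y \<subseteq> colon R I (x + y)"
      using submodD(2)[OF I] by (auto simp: colon_def distrib_left)
  qed
  moreover have "null (colon R I (r * x))" if "null (colon R I x)" "r \<in> R" for r x
    using that submodD(3)[OF I]
    by (intro null_mono[OF that(1) colI colI]) (auto simp: colon_def mult.left_commute[of _ r])
  ultimately show ?thesis
    using subring_ofD[OF R] by (auto simp: ideal_of_def saturation_def)
qed

lemma saturation_supset:
  assumes "ideal_of R I"
  shows "I \<subseteq> saturation I"
proof
  fix x assume x: "x \<in> I"
  then have "colon R I x = R" using assms by (auto simp: colon_def ideal_of_def)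
  then show "x \<in> saturation I" using x assms null_self by (auto simp: saturation_def ideal_of_def)
qed

text \<open>For \<open>z\<close> in \<open>(H : y)\<close>, where \<open>H\<close> is the
  saturation, \<open>((I : y) : z) = (I : zy)\<close> is null. So transitivity lifts nullity from
  \<open>(H : y)\<close> to \<open>(I : y)\<close>.\<close>

lemma saturation_saturated:
  assumes "ideal_of R I" "y \<in> R" "null (colon R (saturation I) y)"
  shows "y \<in> saturation I"
proof -
  have I: "submod R I" "submod R (saturation I)"
    using assms(1) saturation_ideal[OF assms(1)] by (auto simp: ideal_of_iff_submod)
  have "null (colon R I y)"
  proof (rule null_trans[OF colon_ideal[OF R I(1)] colon_ideal[OF R I(2)] assms(3)])
    fix z assume z: "z \<in> colon R (saturation I) y"
    then have "colon R (colon R I y) z = colon R I (z * y)"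
      using subring_ofD(5)[OF R] by (auto simp: colon_def mult.assoc)
    then show "null (colon R (colon R I y) z)"
      using z by (simp add: colon_def saturation_def)
  qed
  then show ?thesis using assms(2) by (simp add: saturation_def)
qed

end

section \<open>Maximal ideals and localizations\<close>

lemma gen_ideal_ideal:
  assumes "subring_of A" "X \<subseteq> A"
  shows "ideal_of A (gen_ideal A X)"
  unfolding ideal_of_def
proof (intro conjI ballI subsetI)
  note A = subring_ofD[OF assms(1)]
  have "(\<Sum>i<n. t i * x i) \<in> A" if "\<forall>i<n. t i \<in> A \<and> x i \<in> X" for n :: nat and t x
    using that by (induction n) (use A assms(2) in auto)
  then show "y \<in> A" if "y \<in> gen_ideal A X" for y using that by (auto simp: gen_ideal_def)
  show "0 \<in> gen_ideal A X" unfolding gen_ideal_def by (intro CollectI exI[of _ "0::nat"]) auto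
  fix a assume "a \<in> gen_ideal A X"
  then obtain n :: nat and t x where a: "a = (\<Sum>i<n. t i * x i)" "\<forall>i<n. t i \<in> A \<and> x i \<in> X"
    by (auto simp: gen_ideal_def)
  {
    fix b assume "b \<in> gen_ideal A X"
    then obtain m :: nat and u y where b: "b = (\<Sum>i<m. u i * y i)" "\<forall>i<m. u i \<in> A \<and> y i \<in> X"
      by (auto simp: gen_ideal_def)
    define w where "w i = (if i < n then t i else u (i - n))" for i
    define z where "z i = (if i < n then x i else y (i - n))" for i
    have split: "(\<Sum>i<n + m. f i) = (\<Sum>i<n. f i) + (\<Sum>i<m. f (n + i))" for f :: "nat \<Rightarrow> 'a"
      by (induction m) (simp_all add: add.assoc)
    have "(\<Sum>i<n + m. w i * z i) = a + b"
      unfolding a(1) b(1) split by (simp add: w_def z_def)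
    moreover have "\<forall>i<n + m. w i \<in> A \<and> z i \<in> X" using a b by (auto simp: w_def z_def)
    ultimately show "a + b \<in> gen_ideal A X" 
      unfolding gen_ideal_def by (intro CollectI exI[of _ "n + m"] exI[of _ w] exI[of _ z]) auto
  }
  fix r assume r: "r \<in> A"
  have "r * a = (\<Sum>i<n. (r * t i) * x i)" unfolding a by (simp add: sum_distrib_left mult.assoc)
  then show "r * a \<in> gen_ideal A X" 
    unfolding gen_ideal_def using r a(2) A(5)
    by (intro CollectI exI[of _ n] exI[of _ "\<lambda>i. r * t i"] exI[of _ x]) auto
qed

lemma gen_ideal_incl:
  assumes "subring_of A"
  shows "X \<subseteq> gen_ideal A X"
proof
  fix x assume "x \<in> X"
  then show "x \<in> gen_ideal A X"
    unfolding gen_ideal_def using subring_ofD(2)[OF assms]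
    by (intro CollectI exI[of _ "Suc 0"] exI[of _ "\<lambda>_. 1"] exI[of _ "\<lambda>_. x"]) auto
qed

lemma gen_ideal_minimal:
  assumes "submod A N" "X \<subseteq> N"
  shows "gen_ideal A X \<subseteq> N"
proof
  fix a assume "a \<in> gen_ideal A X"
  then obtain n :: nat and t x where a: "a = (\<Sum>i<n. t i * x i)" "\<forall>i<n. t i \<in> A \<and> x i \<in> X"
    by (auto simp: gen_ideal_def)
  from a(2) show "a \<in> N" unfolding a(1)
    by (induction n) (use submodD[OF assms(1)] assms(2) in auto)
qed

lemma max_idealsD:
  assumes "M \<in> max_ideals A"
  shows "ideal_of A M" "M \<subseteq> A" "0 \<in> M" "1 \<notin> M"
  using assms ideal_of_eq_self[of A M] by (auto simp: max_ideals_def ideal_of_def)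

text \<open>The ideal \<open>As + M\<close> strictly contains \<open>M\<close>, hence contains
  \<open>1\<close>. The explicit equation is what later removes denominators.\<close>

lemma max_ideal_inverse:
  assumes A: "subring_of A" and M: "M \<in> max_ideals A" and s: "s \<in> A" "s \<notin> M"
  obtains r p where "r \<in> A" "p \<in> M" "s * r = 1 - p"
proof -
  have M': "submod A M" using max_idealsD(1)[OF M] by (simp add: ideal_of_iff_submod)
  let ?J = "{r * s + n | r n. r \<in> A \<and> n \<in> M}"
  have "?J \<subseteq> A" using s max_idealsD(2)[OF M] by (auto intro!: subring_ofD(3,5)[OF A])
  then have "ideal_of A ?J" using submod_insert[OF A M'] by (simp add: ideal_of_iff_submod)
  moreover have "M \<subseteq> ?J" "s \<in> ?J" using submod_insert_supset[OF A M'] by blast+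
  ultimately have "?J = A" using M s(2) unfolding max_ideals_def by blast
  then have "1 \<in> ?J" using subring_ofD(2)[OF A] by blast
  then obtain r n where "1 = r * s + n" "r \<in> A" "n \<in> M" by blast
  then show thesis using that[of r n] by (simp add: algebra_simps)
qed

lemma max_ideal_prime:
  assumes A: "subring_of A" and M: "M \<in> max_ideals A" and "x \<in> A" "y \<in> A" "x * y \<in> M"
  shows "x \<in> M \<or> y \<in> M"
proof (rule ccontr)
  assume "\<not> ?thesis"
  then obtain r p where rp: "r \<in> A" "p \<in> M" "x * r = 1 - p" and y: "y \<notin> M"
    using max_ideal_inverse[OF A M \<open>x \<in> A\<close>] by blast
  have M': "submod A M" using max_idealsD(1)[OF M] by (simp add: ideal_of_iff_submod)
  have "y * (x * r) = y * (1 - p)" using rp by simp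
  then have "y = r * (x * y) + y * p" by (simp add: algebra_simps)
  then have "y \<in> M"
    using submodD(2,3)[OF M'] rp assms(4,5) by metis
  then show False using y by simp
qed

lemma max_ideal_power:
  assumes A: "subring_of A" and M: "M \<in> max_ideals A" and "x \<in> A" "x ^ n \<in> M"
  shows "x \<in> M"
  using assms(4)
proof (induction n)
  case 0
  then show ?case using max_idealsD(4)[OF M] by simp
next
  case (Suc n)
  then show ?case using max_ideal_prime[OF A M \<open>x \<in> A\<close>, of "x ^ n"] subring_ofD(7)[OF A \<open>x \<in> A\<close>] by auto
qed

lemma max_ideal_prod:
  assumes A: "subring_of A" and M: "M \<in> max_ideals A" and "finite F" "\<And>j. j \<in> F \<Longrightarrow> s j \<in> A \<and> s j \<notin> M"
  shows "prod s F \<in> A \<and> prod s F \<notin> M"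
  using assms(3,4)
  by (induction F)
    (use max_idealsD(4)[OF M] subring_ofD(2,5)[OF A] max_ideal_prime[OF A M] in \<open>auto, blast\<close>)

lemma max_ideal_exists:
  assumes A: "subring_of A" and H: "ideal_of A H" "1 \<notin> H"
  obtains M where "M \<in> max_ideals A" "H \<subseteq> M"
proof -
  \<comment> \<open>Properness is expressed by avoiding \<open>1\<close>, a condition that passes to
    unions of chains.\<close>
  define S where "S = {J. ideal_of A J \<and> H \<subseteq> J \<and> 1 \<notin> J}"
  have "\<exists>M\<in>S. \<forall>X\<in>S. M \<subseteq> X \<longrightarrow> X = M"
  proof (rule subset_Zorn_nonempty)
    show "S \<noteq> {}" using H by (auto simp: S_def)
    fix C assume C: "C \<noteq> {}" "subset.chain S C"
    have "ideal_of A (\<Union>C)"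
      unfolding ideal_of_def
    proof (intro conjI ballI)
      show "\<Union>C \<subseteq> A" "0 \<in> \<Union>C" using C by (auto simp: subset.chain_def S_def ideal_of_def)
      show "a * x \<in> \<Union>C" if "a \<in> A" "x \<in> \<Union>C" for a x
      proof -
        from that obtain X where X: "X \<in> C" "x \<in> X" by blast
        then have "ideal_of A X" using C(2) by (auto simp: subset.chain_def S_def)
        then show ?thesis using X \<open>a \<in> A\<close> unfolding ideal_of_def by blast
      qed
      show "x + y \<in> \<Union>C" if "x \<in> \<Union>C" "y \<in> \<Union>C" for x y
      proof -
        from that obtain X Y where XY: "X \<in> C" "Y \<in> C" "x \<in> X" "y \<in> Y" by blast
        then have "X \<subseteq> Y \<or> Y \<subseteq> X" using C(2) by (auto simp: subset.chain_def)
        then obtain Z where "Z \<in> C" "x \<in> Z" "y \<in> Z" using XY by blast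
        moreover from this have "ideal_of A Z" using C(2) by (auto simp: subset.chain_def S_def)
        ultimately show ?thesis unfolding ideal_of_def by blast
      qed
    qed
    then show "\<Union>C \<in> S" using C by (auto simp: subset.chain_def S_def)
  qed
  then obtain M where M: "M \<in> S" "\<And>X. X \<in> S \<Longrightarrow> M \<subseteq> X \<Longrightarrow> X = M" by blast
  have "M \<in> max_ideals A"
    unfolding max_ideals_def
  proof (intro CollectI conjI allI impI)
    show "ideal_of A M" using M(1) by (simp add: S_def)
    show "M \<noteq> A" using M(1) subring_ofD(2)[OF A] by (auto simp: S_def)
    fix J assume J: "ideal_of A J \<and> M \<subseteq> J"
    show "J = M \<or> J = A"
    proof (cases "1 \<in> J")
      case True
      then show ?thesis using ideal_of_eq_self J by blast
    next
      case False
      then have "J \<in> S" using J M(1) by (auto simp: S_def)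
      then show ?thesis using M(2) J by blast
    qed
  qed
  then show thesis using that M(1) by (auto simp: S_def)
qed

section \<open>Localizations at maximal ideals and overrings\<close>

lemma loc_supset:
  assumes "subring_of R" "P \<in> max_ideals R"
  shows "R \<subseteq> loc R P"
proof
  fix x assume "x \<in> R"
  then show "x \<in> loc R P"
    unfolding loc_def using subring_ofD(2)[OF assms(1)] max_idealsD(4)[OF assms(2)]
    by (intro CollectI exI[of _ x] exI[of _ 1]) auto
qed

lemma loc_subring:
  assumes R: "subring_of R" and P: "P \<in> max_ideals R"
  shows "subring_of (loc R P)"
  unfolding subring_of_def
proof (intro conjI ballI)
  note RD = subring_ofD[OF R]
  show "0 \<in> loc R P" "1 \<in> loc R P" using loc_supset[OF R P] RD by blast+
  fix x y assume "x \<in> loc R P" "y \<in> loc R P"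
  then obtain a s b t where x: "x = a / s" "a \<in> R" "s \<in> R" "s \<notin> P"
    and y: "y = b / t" "b \<in> R" "t \<in> R" "t \<notin> P" by (auto simp: loc_def)
  have nz: "s \<noteq> 0" "t \<noteq> 0" using x y max_idealsD(3)[OF P] by auto
  have st: "s * t \<in> R" "s * t \<notin> P" using x y RD(5) max_ideal_prime[OF R P] by blast+
  have "x + y = (a * t + b * s) / (s * t)" "x - y = (a * t - b * s) / (s * t)" "x * y = (a * b) / (s * t)"
    unfolding x y using nz by (simp_all add: field_simps)
  moreover have "a * t + b * s \<in> R" "a * t - b * s \<in> R" "a * b \<in> R" using x y by (auto intro!: RD(3-5))
  ultimately show "x + y \<in> loc R P" "x - y \<in> loc R P" "x * y \<in> loc R P"
    unfolding loc_def using st by blast+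
qed

lemma loc_denominator:
  assumes "x \<in> loc R P" "0 \<in> P"
  obtains s where "s \<in> R" "s \<notin> P" "s * x \<in> R"
proof -
  from assms obtain a s where *: "x = a / s" "a \<in> R" "s \<in> R" "s \<notin> P" by (auto simp: loc_def)
  then have "s \<noteq> 0" using assms(2) by blast
  then have "s * x = a" using * by simp
  then show thesis using that * by blast
qed

text \<open>The set is the extension of \<open>I\<close> to \<open>loc R P\<close>, described by
  denominators. With \<open>gen_ideal_minimal\<close> it bounds the extension of \<open>I\<close> to
  any overring inside \<open>loc R P\<close>.\<close>

lemma submod_localization:
  assumes R: "subring_of R" and P: "P \<in> max_ideals R" and I: "submod R I"
  shows "submod (loc R P) {x. \<exists>s\<in>R. s \<notin> P \<and> s * x \<in> I}" (is "submod _ ?Q")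
  unfolding submod_def
proof (intro conjI ballI)
  note ID = submodD[OF I]
  show "0 \<in> ?Q" using ID(1) max_idealsD(4)[OF P] subring_ofD(2)[OF R] by auto
  fix x assume "x \<in> ?Q"
  then obtain s where s: "s \<in> R" "s \<notin> P" "s * x \<in> I" by blast
  {
    fix y assume "y \<in> ?Q"
    then obtain t where t: "t \<in> R" "t \<notin> P" "t * y \<in> I" by blast
    have "t * (s * x) + s * (t * y) \<in> I" using s t ID by blast
    then have "(s * t) * (x + y) \<in> I" by (simp add: algebra_simps)
    moreover have "s * t \<in> R" "s * t \<notin> P"
      using s t subring_ofD(5)[OF R] max_ideal_prime[OF R P] by blast+
    ultimately show "x + y \<in> ?Q" by blast
  }
  fix r assume "r \<in> loc R P"
  then obtain t where t: "t \<in> R" "t \<notin> P" "t * r \<in> R"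
    using loc_denominator max_idealsD(3)[OF P] by blast
  have "(t * r) * (s * x) \<in> I" using s t ID(3) by blast
  then have "(s * t) * (r * x) \<in> I" by (simp add: algebra_simps)
  moreover have "s * t \<in> R" "s * t \<notin> P"
    using s t subring_ofD(5)[OF R] max_ideal_prime[OF R P] by blast+
  ultimately show "r * x \<in> ?Q" by blast
qed

lemma T_of_subring:
  assumes "subring_of R" "C \<subseteq> max_ideals R"
  shows "subring_of (T_of R C)" "R \<subseteq> T_of R C"
proof -
  have "subring_of (loc R P)" if "P \<in> C" for P using loc_subring assms that by blast
  then show "subring_of (T_of R C)" unfolding subring_of_def T_of_def by blast
  show "R \<subseteq> T_of R C" unfolding T_of_def using loc_supset assms by blast
qed

text \<open>Every element of an overring inside \<open>loc R P\<close> is congruent to an element of \<open>R\<close>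
  modulo the extension of \<open>P\<close>, so the residue field does not change.\<close>

lemma extended_max_ideal:
  assumes R: "subring_of R" and P: "P \<in> max_ideals R"
    and T: "subring_of T" "R \<subseteq> T" "T \<subseteq> loc R P"
  shows "gen_ideal T P \<in> max_ideals T"
  unfolding max_ideals_def
proof (intro CollectI conjI allI impI)
  note PD = max_idealsD[OF P]
  have PT: "P \<subseteq> T" using PD(2) T(2) by blast
  show PTi: "ideal_of T (gen_ideal T P)" using gen_ideal_ideal[OF T(1) PT] .
  show "gen_ideal T P \<noteq> T"
  proof
    assume "gen_ideal T P = T"
    then have 1: "1 \<in> gen_ideal T P" using subring_ofD(2)[OF T(1)] by simp
    \<comment> \<open>This is the extension of \<open>P\<close> to \<open>loc R P\<close>. It
      contains the extension to \<open>T\<close>, and \<open>1\<close> in it would put an element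
      outside \<open>P\<close> into \<open>P\<close>.\<close>
    let ?Q = "{x. \<exists>s\<in>R. s \<notin> P \<and> s * x \<in> P}"
    have "submod T ?Q"
      using submod_subring[OF submod_localization[OF R P] T(3)] PD(1) by (simp add: ideal_of_iff_submod)
    moreover have "P \<subseteq> ?Q" using PD subring_ofD(2)[OF R] by (auto intro!: bexI[of _ 1])
    ultimately have "1 \<in> ?Q" using gen_ideal_minimal 1 by blast
    then show False by simp
  qed
  fix J assume J: "ideal_of T J \<and> gen_ideal T P \<subseteq> J"
  have PJ: "P \<subseteq> J" using J gen_ideal_incl[OF T(1)] by blast
  have Jm: "submod T J" using J by (simp add: ideal_of_iff_submod)
  \<comment> \<open>If \<open>J\<close> meets \<open>R\<close> only inside \<open>P\<close>,
    clearing denominators shows that \<open>J\<close> is no larger than the extension of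
    \<open>P\<close>. Otherwise \<open>J\<close> contains an element of \<open>R\<close> invertible
    modulo \<open>P\<close>, and thus \<open>1\<close>.\<close>
  show "J = gen_ideal T P \<or> J = T"
  proof (cases "J \<inter> R \<subseteq> P")
    case True
    have "J \<subseteq> gen_ideal T P"
    proof
      fix t assume t: "t \<in> J"
      then have tT: "t \<in> T" using J by (auto simp: ideal_of_def)
      then obtain s where s: "s \<in> R" "s \<notin> P" "s * t \<in> R"
        using loc_denominator[of t R P] T(3) PD(3) by blast
      obtain r p where rp: "r \<in> R" "p \<in> P" "s * r = 1 - p" using max_ideal_inverse[OF R P s(1,2)] by blast
      have "t * (s * r) = t * (1 - p)" using rp by simp
      then have eq: "t = r * (s * t) + t * p" by (simp add: algebra_simps)
      have "s * t \<in> J" using submodD(3)[OF Jm _ t] s T(2) by blast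
      then have "s * t \<in> P" using True s by blast
      then have "s * t \<in> gen_ideal T P" "p \<in> gen_ideal T P" using gen_ideal_incl[OF T(1)] rp by blast+
      then have "r * (s * t) \<in> gen_ideal T P" "t * p \<in> gen_ideal T P"
        using PTi tT rp T(2) by (auto simp: ideal_of_def)
      then have "r * (s * t) + t * p \<in> gen_ideal T P" using PTi by (simp add: ideal_of_def)
      then show "t \<in> gen_ideal T P" using eq by simp
    qed
    then show ?thesis using J by blast
  next
    case False
    then obtain s where s: "s \<in> J" "s \<in> R" "s \<notin> P" by blast
    obtain r p where rp: "r \<in> R" "p \<in> P" "s * r = 1 - p" using max_ideal_inverse[OF R P s(2,3)] by blast
    have "1 = r * s + p" using rp by (simp add: algebra_simps)
    moreover have "r * s \<in> J" "p \<in> J" using submodD(3)[OF Jm _ s(1)] rp T(2) PJ by auto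
    ultimately have "1 \<in> J" using submodD(2)[OF Jm] by metis
    then show ?thesis using ideal_of_eq_self J by blast
  qed
qed

text \<open>The denominator \<open>s\<close> must be inverted modulo the square of \<open>N\<close>.
  From \<open>s * r = 1 - p\<close> follows \<open>s * r * (1 + p) = 1 - p * p\<close>, so
  \<open>x\<close> is a \<open>T\<close>-combination of \<open>a * b\<close> and
  \<open>p * p\<close>.\<close>

lemma mem_extended_ideal_square:
  assumes R: "subring_of R" and N: "N \<in> max_ideals R"
    and T: "subring_of T" "R \<subseteq> T" and x: "x \<in> T"
    and s: "s \<in> R" "s \<notin> N" and ab: "s * x = a * b" "a \<in> N" "b \<in> N"
  shows "x \<in> ideal_square T (gen_ideal T N)"
proof -
  note ND = max_idealsD[OF N]
  have NT: "N \<subseteq> T" using ND(2) T(2) by blast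
  have NG: "N \<subseteq> gen_ideal T N" using gen_ideal_incl[OF T(1)] .
  let ?X = "{a * b | a b. a \<in> gen_ideal T N \<and> b \<in> gen_ideal T N}"
  have "gen_ideal T N \<subseteq> T" using gen_ideal_ideal[OF T(1) NT] by (simp add: ideal_of_def)
  then have "?X \<subseteq> T" using subring_ofD(5)[OF T(1)] by blast
  then have sq: "submod T (gen_ideal T ?X)" using gen_ideal_ideal[OF T(1)] by (simp add: ideal_of_iff_submod)
  obtain r p where rp: "r \<in> R" "p \<in> N" "s * r = 1 - p" using max_ideal_inverse[OF R N s] by blast
  have rT: "r * (1 + p) \<in> T" using rp T(2) NT by (auto intro!: subring_ofD(2,3,5)[OF T(1)])
  have "(s * r) * (1 + p) = 1 - p * p" unfolding rp(3) by (simp add: algebra_simps)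
  then have "x * ((s * r) * (1 + p)) = x * (1 - p * p)" by simp
  then have "x = (r * (1 + p)) * (s * x) + x * (p * p)" by (simp add: algebra_simps)
  then have eq: "x = (r * (1 + p)) * (a * b) + x * (p * p)" using ab(1) by simp
  have "a * b \<in> ?X" "p * p \<in> ?X" using ab rp NG by blast+
  then have "a * b \<in> gen_ideal T ?X" "p * p \<in> gen_ideal T ?X"
    using subsetD[OF gen_ideal_incl[OF T(1), of ?X]] by fast+
  then have "(r * (1 + p)) * (a * b) + x * (p * p) \<in> gen_ideal T ?X"
    using submodD(2)[OF sq] submodD(3)[OF sq rT] submodD(3)[OF sq x] by blast
  then show ?thesis using eq unfolding ideal_square_def by simp
qed

section \<open>Valuations of an almost Dedekind domain\<close>

text \<open>The conditions of \<open>is_DVR\<close> for the localization, with the valuation exposed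
  so that one can be fixed for each maximal ideal. The value at \<open>0\<close> is arbitrary, hence
  the nonzero guards.\<close>

definition valuation_at :: "'k::field set \<Rightarrow> 'k set \<Rightarrow> ('k \<Rightarrow> int) \<Rightarrow> bool" where
  "valuation_at R M v \<longleftrightarrow>
     (\<forall>x y. x \<noteq> 0 \<longrightarrow> y \<noteq> 0 \<longrightarrow> v (x * y) = v x + v y) \<and>
     (\<forall>x y. x \<noteq> 0 \<longrightarrow> y \<noteq> 0 \<longrightarrow> x + y \<noteq> 0 \<longrightarrow> v (x + y) \<ge> min (v x) (v y)) \<and>
     (\<exists>x. x \<noteq> 0 \<and> v x = 1) \<and>
     loc R M = {x. x = 0 \<or> v x \<ge> 0}"

lemma valuation_atD:
  assumes "valuation_at R M v"
  shows "\<And>x y. x \<noteq> 0 \<Longrightarrow> y \<noteq> 0 \<Longrightarrow> v (x * y) = v x + v y"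
    "\<And>x y. x \<noteq> 0 \<Longrightarrow> y \<noteq> 0 \<Longrightarrow> x + y \<noteq> 0 \<Longrightarrow> v (x + y) \<ge> min (v x) (v y)"
    "\<exists>x. x \<noteq> 0 \<and> v x = 1"
    "\<And>x. x \<in> loc R M \<longleftrightarrow> x = 0 \<or> v x \<ge> 0"
    "v 1 = 0" "\<And>x n. x \<noteq> 0 \<Longrightarrow> v (x ^ n) = int n * v x"
    "\<And>x y. x \<noteq> 0 \<Longrightarrow> y \<noteq> 0 \<Longrightarrow> v (x / y) = v x - v y"
proof -
  show mult: "\<And>x y. x \<noteq> 0 \<Longrightarrow> y \<noteq> 0 \<Longrightarrow> v (x * y) = v x + v y"
    and "\<And>x y. x \<noteq> 0 \<Longrightarrow> y \<noteq> 0 \<Longrightarrow> x + y \<noteq> 0 \<Longrightarrow> v (x + y) \<ge> min (v x) (v y)"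
    and "\<exists>x. x \<noteq> 0 \<and> v x = 1"
    and "\<And>x. x \<in> loc R M \<longleftrightarrow> x = 0 \<or> v x \<ge> 0"
    using assms unfolding valuation_at_def by blast+
  show one: "v 1 = 0" using mult[of 1 1] by simp
  show "v (x ^ n) = int n * v x" if "x \<noteq> 0" for x n
    using that by (induction n) (auto simp: one mult algebra_simps)
  show "v (x / y) = v x - v y" if "x \<noteq> 0" "y \<noteq> 0" for x y
    using mult[of "x / y" y] that by simp
qed

lemma almost_dedekind_valuation:
  assumes "almost_dedekind R" "M \<in> max_ideals R"
  shows "\<exists>v. valuation_at R M v"
  using assms unfolding almost_dedekind_def is_DVR_def valuation_at_def by blast

lemma valuation_unit:
  assumes R: "subring_of R" and M: "M \<in> max_ideals R" and v: "valuation_at R M v"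
    and s: "s \<in> R" "s \<notin> M"
  shows "v s = 0"
proof -
  note vD = valuation_atD[OF v]
  have s0: "s \<noteq> 0" using s max_idealsD(3)[OF M] by blast
  have "1 / s \<in> loc R M" unfolding loc_def using s subring_ofD(2)[OF R] by blast
  then have "v (1 / s) \<ge> 0" using vD(4) s0 by auto
  moreover have "v s \<ge> 0" using vD(4)[of s] loc_supset[OF R M] s s0 by auto
  ultimately show ?thesis using vD(7)[of 1 s] vD(5) s0 by simp
qed

lemma valuation_max_ideal:
  assumes R: "subring_of R" and M: "M \<in> max_ideals R" and v: "valuation_at R M v"
    and x: "x \<in> R" "x \<noteq> 0"
  shows "x \<in> M \<longleftrightarrow> v x \<ge> 1"
proof
  note vD = valuation_atD[OF v]
  assume xM: "x \<in> M"
  have "\<not> v x \<le> 0"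
  proof
    assume "v x \<le> 0"
    then have "1 / x \<in> loc R M" using vD(4)[of "1 / x"] vD(5) vD(7)[of 1 x] x by simp
    then obtain s where s: "s \<in> R" "s \<notin> M" "s * (1 / x) \<in> R"
      using loc_denominator max_idealsD(3)[OF M] by blast
    then have "(s * (1 / x)) * x \<in> M" using xM max_idealsD(1)[OF M] unfolding ideal_of_def by blast
    then show False using s x by simp
  qed
  then show "v x \<ge> 1" by simp
next
  assume "v x \<ge> 1"
  then show "x \<in> M" using valuation_unit[OF R M v x(1)] by force
qed

text \<open>Zero and the elements of positive value form a \<open>T\<close>-submodule containing
  \<open>M\<close>.\<close>

lemma valuation_extended_ideal:
  assumes R: "subring_of R" and M: "M \<in> max_ideals R" and v: "valuation_at R M v"
    and T: "T \<subseteq> loc R M" and x: "x \<in> gen_ideal T M" "x \<noteq> 0"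
  shows "v x \<ge> 1"
proof -
  note vD = valuation_atD[OF v]
  let ?Q = "{x. x = 0 \<or> v x \<ge> 1}"
  have "submod T ?Q"
    unfolding submod_def
  proof (intro conjI ballI)
    show "0 \<in> ?Q" by simp
    fix a assume a: "a \<in> ?Q"
    show "a + b \<in> ?Q" if "b \<in> ?Q" for b
      using a that vD(2)[of a b] by (cases "a = 0"; cases "b = 0") force+
    show "t * a \<in> ?Q" if "t \<in> T" for t
      using that T vD(4)[of t] vD(1)[of t a] a by (cases "a = 0"; cases "t = 0") auto
  qed
  moreover have "M \<subseteq> ?Q" using valuation_max_ideal[OF R M v] max_idealsD(2)[OF M] by blast
  ultimately have "x \<in> ?Q" using gen_ideal_minimal x(1) by blast
  then show ?thesis using x(2) by simp
qed

text \<open>By contraposition: an element of value at least 2 is a uniformizer times an element of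
  positive value. After clearing denominators both factors lie in \<open>M\<close>, and
  \<open>mem_extended_ideal_square\<close> applies.\<close>

lemma valuation_not_mem_ideal_square:
  assumes R: "subring_of R" and M: "M \<in> max_ideals R" and v: "valuation_at R M v"
    and T: "subring_of T" "R \<subseteq> T" "T \<subseteq> loc R M"
    and x: "x \<in> T" "x \<notin> ideal_square T (gen_ideal T M)"
  shows "x \<noteq> 0 \<and> v x \<le> 1"
proof (rule ccontr)
  assume neg: "\<not> ?thesis"
  note vD = valuation_atD[OF v] and MD = max_idealsD[OF M]
  \<comment> \<open>A multiplier outside \<open>M\<close> is a unit of the localization, so it moves
    \<open>z\<close> into \<open>R\<close> without changing its value.\<close>
  have frac: "\<exists>s\<in>R. s \<notin> M \<and> s * z \<in> R \<and> s * z \<noteq> 0 \<and> v (s * z) = v z" if z: "z \<noteq> 0" "v z \<ge> 0" for z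
  proof -
    from z have "z \<in> loc R M" using vD(4) by blast
    then obtain s where s: "s \<in> R" "s \<notin> M" "s * z \<in> R" using loc_denominator MD(3) by blast
    moreover have "s \<noteq> 0" using s MD(3) by blast
    ultimately show ?thesis
      using valuation_unit[OF R M v s(1,2)] vD(1)[of s z] z by (intro bexI[of _ s]) auto
  qed
  have "\<exists>s\<in>R. s \<notin> M \<and> (\<exists>a\<in>M. \<exists>b\<in>M. s * x = a * b)"
  proof (cases "x = 0")
    case True
    then show ?thesis using MD(3,4) subring_ofD(2)[OF R] by (intro bexI[of _ 1]) auto
  next
    case False
    then have vx: "v x \<ge> 2" using neg by auto
    obtain u where u: "u \<noteq> 0" "v u = 1" using vD(3) by blast
    then obtain s where s: "s \<in> R" "s \<notin> M" "s * u \<in> R" "s * u \<noteq> 0" "v (s * u) = 1"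
      using frac[of u] by auto
    have "v (x / (s * u)) \<ge> 1" using vD(7)[of x "s * u"] False s vx by simp
    then obtain t where t: "t \<in> R" "t \<notin> M" "t * (x / (s * u)) \<in> R" "t * (x / (s * u)) \<noteq> 0"
        "v (t * (x / (s * u))) \<ge> 1"
      using frac[of "x / (s * u)"] False s(4) by auto
    have "s * u \<in> M" "t * (x / (s * u)) \<in> M"
      using valuation_max_ideal[OF R M v] s t by auto
    moreover have "t * x = (s * u) * (t * (x / (s * u)))" using s(4) by simp
    ultimately show ?thesis using t by blast
  qed
  then show False using mem_extended_ideal_square[OF R M T(1,2) x(1)] x(2) by blast
qed

section \<open>The radical of an ideal\<close>

lemma rad_ideal:
  assumes R: "subring_of R" and I: "ideal_of R I"
  shows "ideal_of R (rad R I)"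
  unfolding ideal_of_def
proof (intro conjI ballI)
  note RD = subring_ofD[OF R]
  have Im: "submod R I" "I \<subseteq> R" using I by (auto simp: ideal_of_iff_submod)
  note ID = submodD[OF Im(1)]
  show "rad R I \<subseteq> R" by (auto simp: rad_def)
  show "0 \<in> rad R I" using RD(1) ID(1) unfolding rad_def by (auto intro!: exI[of _ "Suc 0"])
  show "a * x \<in> rad R I" if "a \<in> R" "x \<in> rad R I" for a x
  proof -
    from that obtain n where "x \<in> R" "x ^ n \<in> I" by (auto simp: rad_def)
    then have "(a * x) ^ n \<in> I" "a * x \<in> R"
      using ID(3) RD(5,7) that(1) by (auto simp: power_mult_distrib)
    then show ?thesis by (auto simp: rad_def)
  qed
  show "x + y \<in> rad R I" if "x \<in> rad R I" "y \<in> rad R I" for x y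
  proof -
    from that obtain n m where x: "x \<in> R" "x ^ n \<in> I" and y: "y \<in> R" "y ^ m \<in> I" by (auto simp: rad_def)
    have nat: "of_nat i \<in> R" for i using RD(1-3) by (induction i) auto
    \<comment> \<open>Each term of the binomial expansion is a multiple of \<open>x ^ n\<close> or
      of \<open>y ^ m\<close>.\<close>
    have "of_nat ((n + m) choose k) * x ^ k * y ^ (n + m - k) \<in> I" for k
    proof (cases "n \<le> k")
      case True
      then have "x ^ k = x ^ (k - n) * x ^ n" by (simp flip: power_add)
      then have "of_nat ((n + m) choose k) * x ^ k * y ^ (n + m - k) =
          (of_nat ((n + m) choose k) * x ^ (k - n) * y ^ (n + m - k)) * x ^ n"
        by (simp add: mult_ac)
      moreover have "of_nat ((n + m) choose k) * x ^ (k - n) * y ^ (n + m - k) \<in> R"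
        using nat RD(5,7) x(1) y(1) by auto
      ultimately show ?thesis using ID(3) x(2) by metis
    next
      case False
      then have "n + m - k = (n - k) + m" by simp
      then have "of_nat ((n + m) choose k) * x ^ k * y ^ (n + m - k) =
          (of_nat ((n + m) choose k) * x ^ k * y ^ (n - k)) * y ^ m"
        by (simp add: mult_ac power_add)
      moreover have "of_nat ((n + m) choose k) * x ^ k * y ^ (n - k) \<in> R"
        using nat RD(5,7) x(1) y(1) by auto
      ultimately show ?thesis using ID(3) y(2) by metis
    qed
    moreover have "sum f S \<in> I" if "finite S" "\<And>k. f k \<in> I" for f and S :: "nat set"
      using that by (induction S) (use ID in auto)
    ultimately have "(x + y) ^ (n + m) \<in> I" unfolding binomial_ring by simp
    then show ?thesis using RD(3) x y by (auto simp: rad_def)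
  qed
qed

section \<open>The critical sets\<close>

text \<open>\<open>cut\<close> comes from \<open>wfrec\<close>: the recursive argument agrees with
  \<open>crit_rec\<close> only below \<gamma>, which is where the body evaluates it.\<close>

lemma crit_rec_unfold:
  fixes \<gamma> :: "'o::wellorder"
  shows "crit_rec R \<gamma> = (let f = cut (crit_rec R) {(x, y). x < y} \<gamma> in
     if (\<forall>\<beta>. \<not> \<beta> < \<gamma>) then max_ideals R
     else if (\<exists>\<beta>. \<beta> < \<gamma> \<and> (\<forall>\<delta>. \<delta> < \<gamma> \<longrightarrow> \<delta> \<le> \<beta>)) then
       (let \<beta> = (THE \<beta>. \<beta> < \<gamma> \<and> (\<forall>\<delta>. \<delta> < \<gamma> \<longrightarrow> \<delta> \<le> \<beta>)) in
         {P \<in> max_ideals R. gen_ideal (T_of R (f \<beta>)) P \<in> Crit (T_of R (f \<beta>))})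
     else \<Inter> (f ` {\<beta>. \<beta> < \<gamma>}))"
  unfolding Let_def[of "cut _ _ _"] crit_rec_def by (rule wfrec[OF wf])

lemma crit_rec_zero: "(\<And>\<beta>. \<not> \<beta> < \<gamma>) \<Longrightarrow> crit_rec R \<gamma> = max_ideals R"
  by (simp add: crit_rec_unfold)

lemma crit_rec_succ:
  fixes \<gamma> :: "'o::wellorder"
  assumes "\<beta> < \<gamma>" "\<And>\<delta>. \<delta> < \<gamma> \<Longrightarrow> \<delta> \<le> \<beta>"
  shows "crit_rec R \<gamma> =
    {P \<in> max_ideals R. gen_ideal (T_of R (crit_rec R \<beta>)) P \<in> Crit (T_of R (crit_rec R \<beta>))}"
proof -
  have "(THE \<beta>. \<beta> < \<gamma> \<and> (\<forall>\<delta>. \<delta> < \<gamma> \<longrightarrow> \<delta> \<le> \<beta>)) = \<beta>"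
    using assms by (intro the_equality) (auto intro: antisym)
  moreover have "\<exists>\<beta>. \<beta> < \<gamma> \<and> (\<forall>\<delta>. \<delta> < \<gamma> \<longrightarrow> \<delta> \<le> \<beta>)" "\<not> (\<forall>\<beta>. \<not> \<beta> < \<gamma>)"
    using assms by blast+
  ultimately show ?thesis
    using assms(1) by (subst crit_rec_unfold) (simp only: Let_def if_True if_False cut_apply mem_Collect_eq prod.case)
qed

lemma crit_rec_limit:
  fixes \<gamma> :: "'o::wellorder"
  assumes "\<beta> < \<gamma>" "\<not> (\<exists>\<beta>. \<beta> < \<gamma> \<and> (\<forall>\<delta>. \<delta> < \<gamma> \<longrightarrow> \<delta> \<le> \<beta>))"
  shows "crit_rec R \<gamma> = \<Inter> (crit_rec R ` {\<beta>. \<beta> < \<gamma>})"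
proof -
  have "\<not> (\<forall>\<beta>. \<not> \<beta> < \<gamma>)" using assms(1) by blast
  moreover have "cut (crit_rec R) {(x, y). x < y} \<gamma> ` {\<beta>. \<beta> < \<gamma>} = crit_rec R ` {\<beta>. \<beta> < \<gamma>}"
    by (intro image_cong) (auto simp: cut_apply)
  ultimately show ?thesis
    using assms(2) by (subst crit_rec_unfold) (simp only: Let_def if_False)
qed

lemma crit_rec_subset:
  fixes \<gamma> :: "'o::wellorder"
  shows "crit_rec R \<gamma> \<subseteq> max_ideals R"
proof (induction \<gamma> rule: less_induct)
  case (less \<gamma>)
  consider "\<And>\<beta>. \<not> \<beta> < \<gamma>" | \<beta> where "\<beta> < \<gamma>" "\<And>\<delta>. \<delta> < \<gamma> \<Longrightarrow> \<delta> \<le> \<beta>"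
    | \<beta> where "\<beta> < \<gamma>" "\<not> (\<exists>\<beta>. \<beta> < \<gamma> \<and> (\<forall>\<delta>. \<delta> < \<gamma> \<longrightarrow> \<delta> \<le> \<beta>))" by blast
  then show ?case
  proof cases
    case 1
    then show ?thesis by (simp add: crit_rec_zero)
  next
    case 2
    then show ?thesis using crit_rec_succ by blast
  next
    case 3
    then show ?thesis using crit_rec_limit[OF 3] less.IH by blast
  qed
qed

text \<open>Take the least index at which some member of \<open>V\<close> has left. It is not the
  bottom, where all maximal ideals are present, nor a limit, where the set is the intersection of
  the earlier ones. The resulting \<open>P\<close> may differ from the given one.\<close>

lemma first_exit_is_successor:
  fixes \<alpha> :: "'o::wellorder"
  assumes "V \<subseteq> max_ideals R" "P \<in> V" "P \<notin> crit_rec R \<alpha>"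
  obtains \<gamma> :: 'o and P where "V \<subseteq> crit_rec R \<gamma>" "P \<in> V"
    "gen_ideal (T_of R (crit_rec R \<gamma>)) P \<notin> Crit (T_of R (crit_rec R \<gamma>))"
proof -
  define \<delta> where "\<delta> = (LEAST d :: 'o. \<exists>P\<in>V. P \<notin> crit_rec R d)"
  have ex: "\<exists>P\<in>V. P \<notin> crit_rec R \<delta>"
    unfolding \<delta>_def by (rule LeastI_ex) (use assms in blast)
  have below: "V \<subseteq> crit_rec R d" if "d < \<delta>" for d
    using not_less_Least that unfolding \<delta>_def by blast
  consider "\<And>\<beta>. \<not> \<beta> < \<delta>" | \<beta> where "\<beta> < \<delta>" "\<And>d. d < \<delta> \<Longrightarrow> d \<le> \<beta>"
    | \<beta> where "\<beta> < \<delta>" "\<not> (\<exists>\<beta>. \<beta> < \<delta> \<and> (\<forall>d. d < \<delta> \<longrightarrow> d \<le> \<beta>))" by blast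
  then show thesis
  proof cases
    case 1
    then show ?thesis using ex assms(1) crit_rec_zero by blast
  next
    case 2
    then show ?thesis using that[OF below] ex assms(1) crit_rec_succ[OF 2] by blast
  next
    case 3
    then show ?thesis using crit_rec_limit[OF 3] ex below by blast
  qed
qed

section \<open>Null ideals and critical sets\<close>

context singular_length
begin

text \<open>Induction on the deficit \<open>k\<close>. At \<open>k = 0\<close> the element
  \<open>y\<close> lies in \<open>a\<close> times each relevant localization, so
  \<open>(H : y)\<close> is in no maximal ideal. An element of the radical has positive value at
  each maximal ideal containing \<open>H\<close>; multiplying by it lowers the deficit by one, and
  saturation then removes the factor.\<close>

lemma mem_saturation_of_valuations:
  assumes I: "ideal_of R I" and rad: "null (rad R I)" and a: "a \<in> saturation I" "a \<noteq> 0"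
    and v: "\<And>N. N \<in> max_ideals R \<Longrightarrow> valuation_at R N (v N)"
  shows "y \<in> R \<Longrightarrow> (\<And>N. N \<in> max_ideals R \<Longrightarrow> saturation I \<subseteq> N \<Longrightarrow> y = 0 \<or> v N a \<le> v N y + int k)
    \<Longrightarrow> y \<in> saturation I"
proof (induction k arbitrary: y)
  let ?H = "saturation I"
  have H: "ideal_of R ?H" "submod R ?H"
    using saturation_ideal[OF I] by (auto simp: ideal_of_iff_submod)
  {
    case 0
    have "1 \<in> colon R ?H y"
    proof (rule ccontr)
      assume "1 \<notin> colon R ?H y"
      then obtain N where N: "N \<in> max_ideals R" "colon R ?H y \<subseteq> N"
        using max_ideal_exists[OF R colon_ideal[OF R H(2)]] by blast
      note vD = valuation_atD[OF v[OF N(1)]]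
      \<comment> \<open>This places \<open>N\<close> above the saturation, so that the hypothesis on
        values applies to it.\<close>
      have "?H \<subseteq> colon R ?H y"
        using H 0(1) by (auto simp: colon_def ideal_of_def mult.commute[of _ y])
      then have "y = 0 \<or> v N a \<le> v N y" using 0(2)[OF N(1)] N(2) by simp
      then have "y / a \<in> loc R N" using vD(4)[of "y / a"] vD(7)[of y a] a(2) by auto
      then obtain s where s: "s \<in> R" "s \<notin> N" "s * (y / a) \<in> R"
        using loc_denominator max_idealsD(3)[OF N(1)] by blast
      have "s * y = (s * (y / a)) * a" using a(2) by simp
      then have "s * y \<in> ?H" using submodD(3)[OF H(2) s(3) a(1)] by simp
      then show False using s N(2) by (auto simp: colon_def)
    qed
    then show ?case by (simp add: colon_def)
  next
    case (Suc k)
    have "q * y \<in> ?H" if q: "q \<in> rad R I" for q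
    proof (rule Suc.IH)
      have qR: "q \<in> R" using q by (simp add: rad_def)
      then show "q * y \<in> R" using Suc.prems(1) subring_ofD(5)[OF R] by blast
      fix N assume N: "N \<in> max_ideals R" "?H \<subseteq> N"
      obtain n where "q ^ n \<in> I" using q by (auto simp: rad_def)
      then have "q \<in> N" using max_ideal_power[OF R N(1) qR] N(2) saturation_supset[OF I] by blast
      then show "q * y = 0 \<or> v N a \<le> v N (q * y) + int k"
        using valuation_max_ideal[OF R N(1) v[OF N(1)] qR] Suc.prems(2)[OF N]
          valuation_atD(1)[OF v[OF N(1)], of q y] by (cases "q = 0"; cases "y = 0") auto
    qed
    then have "rad R I \<subseteq> colon R ?H y" by (auto simp: colon_def rad_def)
    then have "null (colon R ?H y)"
      using null_mono[OF rad rad_ideal[OF R I] colon_ideal[OF R H(2)]] by blast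
    then show ?case using saturation_saturated[OF I Suc.prems(1)] by blast
  }
qed

lemma null_if_avoids_crit:
  fixes \<alpha> :: "'o::wellorder"
  assumes AD: "almost_dedekind R" and I: "ideal_of R I" and rad: "null (rad R I)"
    and avoid: "\<And>P. P \<in> crit_rec R \<alpha> \<Longrightarrow> \<not> I \<subseteq> P"
  shows "null I"
proof (rule ccontr)
  assume nI: "\<not> null I"
  let ?H = "saturation I"
  have H: "ideal_of R ?H" "I \<subseteq> ?H" using saturation_ideal[OF I] saturation_supset[OF I] .
  have "colon R I 1 = I" using I by (auto simp: colon_def ideal_of_def)
  then have "1 \<notin> ?H" using nI by (simp add: saturation_def)
  define V where "V = {N \<in> max_ideals R. ?H \<subseteq> N}"
  obtain P0 where "P0 \<in> V"
    using max_ideal_exists[OF R H(1) \<open>1 \<notin> ?H\<close>] by (auto simp: V_def)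
  moreover have "P0 \<notin> crit_rec R \<alpha>" using avoid \<open>P0 \<in> V\<close> H(2) unfolding V_def by blast
  ultimately obtain \<gamma> :: 'o and P where \<gamma>: "V \<subseteq> crit_rec R \<gamma>" and PV: "P \<in> V"
    and PC: "gen_ideal (T_of R (crit_rec R \<gamma>)) P \<notin> Crit (T_of R (crit_rec R \<gamma>))"
    using first_exit_is_successor[of V R P0 \<alpha>] by (auto simp: V_def)
  define T where "T = T_of R (crit_rec R \<gamma>)"
  have T: "subring_of T" "R \<subseteq> T" unfolding T_def using T_of_subring[OF R crit_rec_subset] .
  have TN: "T \<subseteq> loc R N" if "N \<in> V" for N using that \<gamma> unfolding T_def T_of_def by blast
  have P: "P \<in> max_ideals R" "?H \<subseteq> P" using PV by (auto simp: V_def)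
  obtain v where v: "\<And>N. N \<in> max_ideals R \<Longrightarrow> valuation_at R N (v N)"
    using almost_dedekind_valuation[OF AD] by metis
  note vP = valuation_atD[OF v[OF P(1)]]
  have "gen_ideal T P \<in> max_ideals T" using extended_max_ideal[OF R P(1) T TN[OF PV]] .
  \<comment> \<open>As the extension of \<open>P\<close> is maximal in \<open>T\<close>, not being
    critical can only mean that some finitely generated ideal inside it lies in no square of a
    maximal ideal.\<close>
  then obtain F where F: "finite F" "F \<subseteq> T" "gen_ideal T F \<subseteq> gen_ideal T P"
    and sq: "\<And>N. N \<in> max_ideals T \<Longrightarrow> \<not> gen_ideal T F \<subseteq> ideal_square T N"
    using PC unfolding T_def[symmetric] Crit_def critical_def fg_ideal_def by blast
  \<comment> \<open>The square is an ideal, so some generator in \<open>F\<close> already lies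
    outside it.\<close>
  have sqF: "\<exists>j\<in>F. j \<noteq> 0 \<and> v N j \<le> 1" if N: "N \<in> V" for N
  proof -
    have NM: "N \<in> max_ideals R" using N by (simp add: V_def)
    have GN: "gen_ideal T N \<in> max_ideals T" using extended_max_ideal[OF R NM T TN[OF N]] .
    have "{a * b | a b. a \<in> gen_ideal T N \<and> b \<in> gen_ideal T N} \<subseteq> T"
      using max_idealsD(2)[OF GN] subring_ofD(5)[OF T(1)] by blast
    then have "submod T (ideal_square T (gen_ideal T N))"
      unfolding ideal_square_def using gen_ideal_ideal[OF T(1)] by (simp add: ideal_of_iff_submod)
    then obtain j where "j \<in> F" "j \<notin> ideal_square T (gen_ideal T N)"
      using sq[OF GN] gen_ideal_minimal by blast
    then show ?thesis
      using valuation_not_mem_ideal_square[OF R NM v[OF NM] T TN[OF N]] F(2) by blast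
  qed
  \<comment> \<open>If the saturation were zero, \<open>I\<close> would be zero and equal to its own
    radical, hence null.\<close>
  obtain a where a: "a \<in> ?H" "a \<noteq> 0"
  proof (rule ccontr)
    assume "\<not> thesis"
    then have "I = {0}" using that H(2) I by (auto simp: ideal_of_def)
    then have "rad R I = I" using subring_ofD(1)[OF R] by (auto simp: rad_def intro!: exI[of _ "Suc 0"])
    then show False using rad nI by simp
  qed
  have aR: "a \<in> R" using a by (simp add: saturation_def)
  have va: "v P a \<ge> 1" using valuation_max_ideal[OF R P(1) v[OF P(1)] aR a(2)] a(1) P(2) by blast
  \<comment> \<open>Elements of \<open>F\<close> have value at least 1 at \<open>P\<close> or
    vanish, so their \<open>k\<close>-th powers are divisible by \<open>a\<close> in
    \<open>loc R P\<close>; \<open>k > 0\<close> covers the element \<open>0\<close>.\<close>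
  define k where "k = nat (v P a)"
  have k: "int k = v P a" "k > 0" using va by (auto simp: k_def)
  have "\<exists>s. s \<in> R \<and> s \<notin> P \<and> s * (j ^ k / a) \<in> R" if j: "j \<in> F" for j
  proof -
    have "j ^ k / a \<in> loc R P"
    proof (cases "j = 0")
      case True
      then show ?thesis using vP(4) k by simp
    next
      case False
      have "v P j \<ge> 1"
        using valuation_extended_ideal[OF R P(1) v[OF P(1)] TN[OF PV] _ False]
          j F(3) gen_ideal_incl[OF T(1)] by blast
      then have "int k * 1 \<le> int k * v P j" by (intro mult_left_mono) auto
      then show ?thesis using vP(4) vP(7)[of "j ^ k" a] vP(6)[OF False, of k] False a(2) k by simp
    qed
    then show ?thesis using loc_denominator max_idealsD(3)[OF P(1)] by metis
  qed
  then obtain s where s: "\<And>j. j \<in> F \<Longrightarrow> s j \<in> R \<and> s j \<notin> P \<and> s j * (j ^ k / a) \<in> R" by metis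
  \<comment> \<open>A common denominator for all \<open>j ^ k / a\<close>, outside \<open>P\<close>
    because \<open>P\<close> is prime.\<close>
  define y where "y = prod s F"
  have y: "y \<in> R" "y \<notin> P" unfolding y_def using max_ideal_prod[OF R P(1) F(1), of s] s by auto
  then have y0: "y \<noteq> 0" using max_idealsD(3)[OF P(1)] by blast
  have yj: "y * (j ^ k / a) \<in> R" if j: "j \<in> F" for j
  proof -
    have "prod s (F - {j}) \<in> R" using max_ideal_prod[OF R P(1), of "F - {j}" s] F(1) s by auto
    moreover have "y * (j ^ k / a) = prod s (F - {j}) * (s j * (j ^ k / a))"
      unfolding y_def prod.remove[OF F(1) j] by (simp add: mult_ac)
    ultimately show ?thesis using s[OF j] subring_ofD(5)[OF R] by metis
  qed
  \<comment> \<open>At each \<open>N\<close> above the saturation, integrality of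
    \<open>y * (j ^ k / a)\<close> for a \<open>j\<close> of value at most 1 bounds the deficit of
    \<open>y\<close> by \<open>k\<close>.\<close>
  have "y \<in> ?H"
  proof (rule mem_saturation_of_valuations[OF I rad a v y(1), where k = k])
    fix N assume N: "N \<in> max_ideals R" "?H \<subseteq> N"
    then have "N \<in> V" by (simp add: V_def)
    then obtain j where j: "j \<in> F" "j \<noteq> 0" "v N j \<le> 1" using sqF by blast
    note vN = valuation_atD[OF v[OF N(1)]]
    have "y * (j ^ k / a) \<in> loc R N" using yj[OF j(1)] loc_supset[OF R N(1)] by blast
    then have "v N (y * (j ^ k / a)) \<ge> 0" using vN(4) y0 j(2) a(2) by simp
    then have "v N y + int k * v N j - v N a \<ge> 0"
      using vN(1)[of y "j ^ k / a"] vN(7)[of "j ^ k" a] vN(6)[OF j(2), of k] y0 j(2) a(2) by simp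
    moreover have "int k * v N j \<le> int k * 1" using j(3) by (intro mult_left_mono) auto
    ultimately show "y = 0 \<or> v N a \<le> v N y + int k" by simp
  qed
  then show False using y(2) P(2) by blast
qed

text \<open>For the converse, transitivity is applied along the contraction to \<open>R\<close> of
  the extension of \<open>I\<close>: the contraction is null, and each of its elements
  \<open>x\<close> has \<open>(I : x)\<close> null by the avoidance lemma.\<close>

lemma null_iff:
  fixes \<alpha> :: "'o::wellorder"
  assumes AD: "almost_dedekind R" and I: "ideal_of R I"
  shows "null I \<longleftrightarrow> null (rad R I) \<and> tensor_colength R ell (T_alpha R \<alpha>) I = 0"
proof -
  define T where "T = T_alpha R \<alpha>"
  have T: "subring_of T" "R \<subseteq> T"
    unfolding T_def T_alpha_def using T_of_subring[OF R crit_rec_subset] .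
  have IR: "I \<subseteq> R" "submod R I" using I by (auto simp: ideal_of_iff_submod)
  let ?G = "gen_ideal T I"
  have G: "submod T ?G" "?G \<subseteq> T"
    using gen_ideal_ideal[OF T(1), of I] IR T(2) by (auto simp: ideal_of_iff_submod)
  have GR: "submod R ?G" "submod R T"
    using submod_subring[OF _ T(2)] G(1) submod_self[OF T(1)] by auto
  have IG: "I \<subseteq> ?G" using gen_ideal_incl[OF T(1)] .
  have tens: "tensor_colength R ell T I = 0 \<longleftrightarrow> (\<forall>x\<in>T. null (colon R ?G x))"
    unfolding tensor_colength_def using ell_quot_eq_0_iff[OF GR G(2)] .
  show ?thesis
    unfolding T_def[symmetric] tens
  proof (intro iffI conjI ballI)
    assume nI: "null I"
    have "I \<subseteq> rad R I" using IR(1) unfolding rad_def by (auto intro!: exI[of _ "Suc 0"])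
    then show "null (rad R I)" using null_mono[OF nI I rad_ideal[OF R I]] by blast
    fix x assume x: "x \<in> T"
    \<comment> \<open>\<open>I\<close> annihilates \<open>T/IT\<close>.\<close>
    have "I \<subseteq> colon R ?G x"
      using submodD(3)[OF G(1) x] IG IR(1) by (auto simp: colon_def mult.commute[of _ x])
    then show "null (colon R ?G x)" using null_mono[OF nI I colon_ideal[OF R GR(1)]] by blast
  next
    assume *: "null (rad R I) \<and> (\<forall>x\<in>T. null (colon R ?G x))"
    \<comment> \<open>Testing the annihilator condition at \<open>1\<close> in \<open>T\<close>
      yields nullity of the contraction.\<close>
    have "colon R ?G 1 = ?G \<inter> R" by (auto simp: colon_def)
    then have "null (?G \<inter> R)" using * subring_ofD(2)[OF T(1)] by metis
    moreover have "ideal_of R (?G \<inter> R)"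
      using colon_ideal[OF R GR(1), of 1] \<open>colon R ?G 1 = ?G \<inter> R\<close> by simp
    moreover have "null (colon R I x)" if x: "x \<in> ?G \<inter> R" for x
    proof (rule null_if_avoids_crit[OF AD colon_ideal[OF R IR(2)]])
      have "rad R I \<subseteq> rad R (colon R I x)"
      proof
        fix q assume "q \<in> rad R I"
        then obtain n where q: "q \<in> R" "q ^ n \<in> I" by (auto simp: rad_def)
        then have "q ^ n \<in> colon R I x"
          using x submodD(3)[OF IR(2), of x] IR(1) by (auto simp: colon_def mult.commute[of _ x])
        then show "q \<in> rad R (colon R I x)" using q by (auto simp: rad_def)
      qed
      then show "null (rad R (colon R I x))"
        using null_mono[OF _ rad_ideal[OF R I] rad_ideal[OF R colon_ideal[OF R IR(2)]]] * by blast
      fix P assume PC: "P \<in> crit_rec R \<alpha>"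
      then have P: "P \<in> max_ideals R" using crit_rec_subset by blast
      \<comment> \<open>Since \<open>T\<close> lies in \<open>loc R P\<close>, \<open>x\<close>
        belongs to this extension of \<open>I\<close>; the multiplier \<open>s\<close> is then in
        \<open>(I : x)\<close> but not in \<open>P\<close>.\<close>
      let ?Q = "{z. \<exists>s\<in>R. s \<notin> P \<and> s * z \<in> I}"
      have "submod T ?Q"
      proof (rule submod_subring[of "loc R P"])
        show "T \<subseteq> loc R P" using PC by (auto simp: T_def T_alpha_def T_of_def)
        show "submod (loc R P) ?Q" using submod_localization[OF R P IR(2)] .
      qed
      moreover have "I \<subseteq> ?Q"
        using subring_ofD(2)[OF R] max_idealsD(4)[OF P] by (auto intro!: bexI[of _ 1])
      ultimately have "x \<in> ?Q" using gen_ideal_minimal x by blast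
      then show "\<not> colon R I x \<subseteq> P" by (auto simp: colon_def)
    qed
    ultimately show "null I" using null_trans[OF I] by blast
  qed
qed

end

theorem theorem7p4:
  fixes R :: "'k::field set" and \<alpha> :: "'o::wellorder"
    and ell :: "('k, 'k set) rmod \<Rightarrow> enat" and I :: "'k set"
  assumes "almost_dedekind R"
    and "\<forall>x. \<exists>a\<in>R. \<exists>b\<in>R. b \<noteq> 0 \<and> x = a / b"
    and "singular_length_function R ell"
    and "ideal_of R I"
  shows "colength R ell I = colength R ell (rad R I) + tensor_colength R ell (T_alpha R \<alpha>) I"
proof -
  interpret singular_length R ell
    using assms by unfold_locales (auto simp: almost_dedekind_def)
  \<comment> \<open>All three lengths are \<open>0\<close> or \<infinity>, so the identity says
    exactly that the left side vanishes if and only if both summands do.\<close>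
  have val: "ell (quot_mod L J) = 0 \<or> ell (quot_mod L J) = \<infinity>" if "submod R J" "submod R L" for J L
  proof -
    have "ell (quot_mod L J) \<in> {0, \<infinity>}"
      using assms(3) quot_mod_is_module[OF R that] unfolding singular_length_function_def by blast
    then show ?thesis by simp
  qed
  define T where "T = T_alpha R \<alpha>"
  have T: "subring_of T" "R \<subseteq> T"
    unfolding T_def T_alpha_def using T_of_subring[OF R crit_rec_subset] .
  have "I \<subseteq> T" using assms(4) T(2) by (auto simp: ideal_of_def)
  then have "submod T (gen_ideal T I)"
    using gen_ideal_ideal[OF T(1)] by (simp add: ideal_of_iff_submod)
  then have "submod R (gen_ideal T I)" "submod R T"
    using submod_subring[OF _ T(2)] submod_self[OF T(1)] by auto
  then have "tensor_colength R ell T I = 0 \<or> tensor_colength R ell T I = \<infinity>"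
    unfolding tensor_colength_def by (rule val)
  moreover have "colength R ell J = 0 \<or> colength R ell J = \<infinity>" if "ideal_of R J" for J
    unfolding colength_def using val that submod_self[OF R] by (simp add: ideal_of_iff_submod)
  note this[OF assms(4)] this[OF rad_ideal[OF R assms(4)]]
  moreover have "colength R ell I = 0 \<longleftrightarrow> colength R ell (rad R I) = 0 \<and> tensor_colength R ell T I = 0"
    using null_iff[OF assms(1,4), of \<alpha>] by (simp add: null_def colength_def T_def)
  ultimately show ?thesis unfolding T_def[symmetric] by auto
qed

end
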